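(* Assume (A1)–(A4) and step sizes satisfying (i) $\sum_k\alpha_{ij,k}^2<\infty$ and $\sup_k\alpha_{ij,k+1}/\alpha_{ij,k}<\infty$ for all $(i,j)\in\mathcal{E}$; (ii) $\sum_k\beta_{i,k}^2<\infty$ and $\sup_k\beta_{i,k+1}/\beta_{i,k}<\infty$ for all $i$; (iii) $\sum_k z_k=\infty$ with $z_k=\min\{\alpha_{ij,k}/k^{\nu_{ij}},(i,j)\in\mathcal{E};\beta_{i,k},i\in\mathcal{V}\}$. Then the global average data rate of Algorithm SC satisfies $\mathtt{B}(k)=O(k^{-\underline\nu})$ almost surely, where $\underline\nu=\min_{(i,j)\in\mathcal{E}}\nu_{ij}$.
   Context: Network: undirected weighted graph with sensor set $\mathcal{V}=\{1,\dots,N\}$, symmetric nonnegative weights $a_{ij}=a_{ji}$, with $a_{ij}>0$ iff $(i,j)\in\mathcal{E}$; the edge set $\mathcal{E}$ is regarded as a set of ordered pairs that is symmetric ($(i,j)\in\mathcal{E}\iff(j,i)\in\mathcal{E}$), $M=|\mathcal{E}|/2$ is the number of undirected edges, and $\mathcal{N}_i=\{j:(i,j)\in\mathcal{E}\}$. The Laplacian is $\mathcal{L}=\mathcal{D}-\mathcal{A}$ with $\mathcal{A}=(a_{ij})$, $\mathcal{D}=\mathrm{diag}(\sum_{j\in\mathcal{N}_i}a_{ij})$; $\lambda_2(\mathcal{L})$ is its second smallest eigenvalue. Observations: unknown $\theta\in\mathbb{R}^n$; sensor $i$ observes $y_{i,k}=H_{i,k}\theta+w_{i,k}$, $k\ge1$,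 with deterministic $H_{i,k}\in\mathbb{R}^{m_i\times n}$ and noise $w_{i,k}\in\mathbb{R}^{m_i}$. Let $d_{i,k}$ ($i\in\mathcal{V},k\ge1$) be the dithering noises used below, $\mathcal{F}_k=\sigma(w_{i,t},d_{i,t}: i\in\mathcal{V},1\le t\le k)$ and $\mathcal{F}^w_k=\sigma(w_{i,t}: i\in\mathcal{V},1\le t\le k)$. Assumptions. (A1) There is $\bar H>0$ with $\|H_{i,k}\|\le\bar H$ for all $i,k$, and there are a positive integer $p$ and $\delta>0$ with $\frac1p\sum_{t=k}^{k+p-1}\sum_{i=1}^N H_{i,t}^\top H_{i,t}\ge\delta I_n$ for all $k\ge1$. (A2) $\{w_{i,k},\mathcal{F}_k\}$ is a martingale difference sequence and $\sup_{i,k}\mathbb{E}[\|w_{i,k}\|^\rho\mid\mathcal{F}^w_{k-1}]<\infty$ a.s. for some $\rho>2$. (A3) The graph is connected, i.e. $\mathrm{rank}(\mathcal{L})=N-1$. (A4) The $d_{i,k}$ are i.i.d. with the Laplace distribution $\mathrm{Lap}(0,1)$ (density $f(x)=\frac12e^{-|x|}$, distribution function $F$), mutually independent over all $(i,k)$, and independent of all $w_{j,t}$. Algorithm SC. Inputs: deterministic initial estimates $\hat\theta_{i,0}\in\mathbb{R}^n$; event-triggered coefficients $\nu_{ij}=\nu_{ji}\ge0$; noise coefficients $b_{ij}=b_{ji}>0$; step sizes $\alpha_{ij,k}=\alpha_{ji,k}>0$ ($(i,j)\in\mathcal{E}$) and $\beta_{i,k}>0$. For $k=1,2,\dots$: let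 $\varphi_k\in\mathbb{R}^n$ be the $l$-th standard basis vector, where $k=nq+l$ with $q\in\mathbb{N}\cup\{0\}$, $l\in\{1,\dots,n\}$; set $x_{i,k}=\varphi_k^\top\hat\theta_{i,k-1}$; set $C_{ij,k}=\nu_{ij}b_{ij}\ln k$; set $s_{ij,k}=1$ if $x_{i,k}+b_{ij}d_{i,k}>0$ and $s_{ij,k}=-1$ otherwise. Sensor $i$ sends the one-bit message $s_{ij,k}$ to neighbor $j$ iff $|x_{i,k}+b_{ij}d_{i,k}|>C_{ij,k}$; sensor $i$ sets $\hat s_{ji,k}=s_{ji,k}$ if it received $s_{ji,k}$ from $j$, and $\hat s_{ji,k}=0$ otherwise. With $G_{ij,k}(x)=F((x-C_{ij,k})/b_{ij})-F((-x-C_{ij,k})/b_{ij})$, update $\check\theta_{i,k}=\hat\theta_{i,k-1}+\varphi_k\sum_{j\in\mathcal{N}_i}\alpha_{ij,k}a_{ij}(\hat s_{ji,k}-G_{ij,k}(x_{i,k}))$, $\hat\theta_{i,k}=\check\theta_{i,k}+\beta_{i,k}H_{i,k}^\top(y_{i,k}-H_{i,k}\hat\theta_{i,k-1})$. Data rates: $\zeta_{ij}(t)\in\{0,1\}$ is the number of bits sensor $i$ sends to $j$ at time $t$ (i.e. $1$ iff $|x_{i,t}+b_{ij}d_{i,t}|>C_{ij,t}$). Local average data rate $\mathtt{B}_{ij}(k)=\frac1k\sum_{t=1}^k\zeta_{ij}(t)$; global average data rate $\mathtt{B}(k)=\frac{1}{2kM}\sum_{(i,j)\in\mathcal{E}}\sum_{t=1}^k\zeta_{ij}(t)$.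 "$X_k=O(r_k)$ a.s." means $\sup_k|X_k|/r_k<\infty$ almost surely. *)

theory Defs
  imports "HOL-Probability.Probability"
begin

text \<open>Sensors are 0,...,N-1; coordinates of R^n are 0,...,n-1 (vectors are nat => real,
  only the first n components matter); the observation matrix H i k is m i x n,
  given as H i k r c (row r < m i, column c < n).\<close>

definition edges :: "nat \<Rightarrow> (nat \<Rightarrow> nat \<Rightarrow> real) \<Rightarrow> (nat \<times> nat) set" where
  "edges N a = {(i,j). i < N \<and> j < N \<and> 0 < a i j}"

definition nbrs :: "nat \<Rightarrow> (nat \<Rightarrow> nat \<Rightarrow> real) \<Rightarrow> nat \<Rightarrow> nat set" where
  "nbrs N a i = {j. (i,j) \<in> edges N a}"

definition lapF :: "real \<Rightarrow> real" where
  "lapF x = (if x < 0 then exp x / 2 else 1 - exp (- x) / 2)"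

definition Cthr :: "(nat \<Rightarrow> nat \<Rightarrow> real) \<Rightarrow> (nat \<Rightarrow> nat \<Rightarrow> real) \<Rightarrow> nat \<Rightarrow> nat \<Rightarrow> nat \<Rightarrow> real" where
  "Cthr nu b i j k = nu i j * b i j * ln (real k)"

definition Gfun :: "(nat \<Rightarrow> nat \<Rightarrow> real) \<Rightarrow> (nat \<Rightarrow> nat \<Rightarrow> real) \<Rightarrow> nat \<Rightarrow> nat \<Rightarrow> nat \<Rightarrow> real \<Rightarrow> real" where
  "Gfun nu b i j k x = lapF ((x - Cthr nu b i j k) / b i j) - lapF ((- x - Cthr nu b i j k) / b i j)"

text \<open>Index (0-based) of the coordinate selected by phi_k: k = n q + l with l in {1..n}
  gives coordinate l - 1 = (k - 1) mod n.\<close>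
definition coord :: "nat \<Rightarrow> nat \<Rightarrow> nat" where
  "coord n k = (k - 1) mod n"

text \<open>Message received by sensor i from sensor j at time k, given x_j = x_{j,k} and dither dj = d_{j,k}.\<close>
definition shat :: "(nat \<Rightarrow> nat \<Rightarrow> real) \<Rightarrow> (nat \<Rightarrow> nat \<Rightarrow> real) \<Rightarrow> nat \<Rightarrow> nat \<Rightarrow> nat \<Rightarrow> real \<Rightarrow> real \<Rightarrow> real" where
  "shat nu b j i k xj dj =
     (if \<bar>xj + b j i * dj\<bar> > Cthr nu b j i k
      then (if xj + b j i * dj > 0 then 1 else -1) else 0)"

text \<open>Estimates of Algorithm SC: est ... k omega i c = c-th component of theta_hat_{i,k}(omega).\<close>
primrec est_SC ::
  "nat \<Rightarrow> nat \<Rightarrow> (nat \<Rightarrow> nat \<Rightarrow> real) \<Rightarrow> (nat \<Rightarrow> nat \<Rightarrow> real) \<Rightarrow> (nat \<Rightarrow> nat \<Rightarrow> real) \<Rightarrow>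
   (nat \<Rightarrow> nat \<Rightarrow> nat \<Rightarrow> real) \<Rightarrow> (nat \<Rightarrow> nat \<Rightarrow> real) \<Rightarrow> (nat \<Rightarrow> nat) \<Rightarrow>
   (nat \<Rightarrow> nat \<Rightarrow> nat \<Rightarrow> nat \<Rightarrow> real) \<Rightarrow> (nat \<Rightarrow> real) \<Rightarrow>
   (nat \<Rightarrow> nat \<Rightarrow> 'a \<Rightarrow> nat \<Rightarrow> real) \<Rightarrow> (nat \<Rightarrow> nat \<Rightarrow> 'a \<Rightarrow> real) \<Rightarrow>
   (nat \<Rightarrow> nat \<Rightarrow> real) \<Rightarrow> nat \<Rightarrow> 'a \<Rightarrow> nat \<Rightarrow> nat \<Rightarrow> real" where
  "est_SC n N a nu b alpha beta m H theta w d theta0 0 \<omega> = theta0"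
| "est_SC n N a nu b alpha beta m H theta w d theta0 (Suc k) \<omega> =
     (let prev = est_SC n N a nu b alpha beta m H theta w d theta0 k \<omega>;
          t = Suc k;
          l = coord n t;
          x = (\<lambda>i. prev i l);
          y = (\<lambda>i r. (\<Sum>c<n. H i t r c * theta c) + w i t \<omega> r)
      in (\<lambda>i c.
           prev i c
           + (if c = l then
                (\<Sum>j\<in>nbrs N a i. alpha i j t * a i j *
                    (shat nu b j i t (x j) (d j t \<omega>) - Gfun nu b i j t (x i)))
              else 0)
           + beta i t * (\<Sum>r<m i. H i t r c * (y i r - (\<Sum>c'<n. H i t r c' * prev i c')))))"

text \<open>zeta_{ij}(t): number of bits sent by i to j at time t (t >= 1).\<close>
definition zeta_SC where
  "zeta_SC n N a nu b alpha beta m H theta w d theta0 i j t \<omega> =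
     (let x = est_SC n N a nu b alpha beta m H theta w d theta0 (t - 1) \<omega> i (coord n t)
      in if \<bar>x + b i j * d i t \<omega>\<bar> > Cthr nu b i j t then (1::real) else 0)"

text \<open>Global average data rate B(k) = 1/(2kM) sum_{(i,j) in E} sum_{t=1..k} zeta_{ij}(t), M = |E|/2.\<close>
definition rate_SC where
  "rate_SC n N a nu b alpha beta m H theta w d theta0 k \<omega> =
     (\<Sum>(i,j)\<in>edges N a. \<Sum>t=1..k. zeta_SC n N a nu b alpha beta m H theta w d theta0 i j t \<omega>)
       / (2 * real k * (real (card (edges N a)) / 2))"

definition gen_alg :: "'a measure \<Rightarrow> ('a \<Rightarrow> real) set \<Rightarrow> 'a measure" where
  "gen_alg M fs = sigma (space M) (\<Union>f\<in>fs. {f -` B \<inter> space M | B. B \<in> sets borel})"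

definition gen_sets :: "'a measure \<Rightarrow> ('a \<Rightarrow> real) set \<Rightarrow> 'a set set" where
  "gen_sets M fs = sigma_sets (space M) (\<Union>f\<in>fs. {f -` B \<inter> space M | B. B \<in> sets borel})"

definition filtF where
  "filtF M N m w d k = gen_alg M
     ({(\<lambda>\<omega>. w i t \<omega> r) | i t r. i < N \<and> 1 \<le> t \<and> t \<le> k \<and> r < m i} \<union>
      {d i t | i t. i < N \<and> 1 \<le> t \<and> t \<le> k})"

definition filtFw where
  "filtFw M N m w k = gen_alg M {(\<lambda>\<omega>. w i t \<omega> r) | i t r. i < N \<and> 1 \<le> t \<and> t \<le> k \<and> r < m i}"

definition vnorm :: "nat \<Rightarrow> (nat \<Rightarrow> real) \<Rightarrow> real" where
  "vnorm n x = sqrt (\<Sum>c<n. (x c)\<^sup>2)"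

definition matvec :: "nat \<Rightarrow> nat \<Rightarrow> (nat \<Rightarrow> nat \<Rightarrow> real) \<Rightarrow> (nat \<Rightarrow> real) \<Rightarrow> nat \<Rightarrow> real" where
  "matvec mm n A x = (\<lambda>r. if r < mm then (\<Sum>c<n. A r c * x c) else 0)"

end

theory Submission
  imports Defs
begin

text \<open>
  Only two facts about the algorithm are needed: the estimates are almost surely bounded, and every
  \<open>\<nu>\<^sub>i\<^sub>j\<close> is at most \<open>1/2\<close>, because \<open>z\<close> is not summable while \<open>\<alpha>\<^sup>2\<close> is.

  Boundedness: let \<open>V\<^sub>k\<close> be the sum of the squared estimation errors. In the one-step expansion of \<open>V\<close>
  the observation term \<open>-H\<^sup>T H\<close> and, after symmetrising over the edges, the consensus term have a
  favourable sign, while the contributions of the noises are centred given the past. Hence \<open>V\<close> is a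
  supermartingale up to factors \<open>1 + O(\<beta>\<^sup>2)\<close> and errors \<open>O(\<alpha>\<^sup>2 + \<beta>\<^sup>2 \<bar>w\<bar>\<^sup>2)\<close>. Since \<open>w\<close> has only a finite
  conditional moment, \<open>V\<close> need not be integrable; it is stopped when the conditional moment exceeds a
  level \<open>L\<close>, or when \<open>V\<close> exceeds a level \<open>l\<close>, and a maximal inequality is applied. The term
  \<open>\<beta>\<^sup>2 \<bar>w\<bar>\<^sup>2\<close> enters only through its expectation on the first of these events, so no conditional
  independence of \<open>w\<close> and \<open>d\<close> is required.

  Rate: if the estimates are bounded by \<open>R\<close>, a bit is sent at time \<open>t\<close> only if
  \<open>\<bar>d\<^sub>t\<bar> > \<nu> ln t - R / b\<close>. These events are independent with probabilities \<open>O(1 / t powr \<nu>)\<close>, and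
  Chebyshev's inequality along powers of two bounds their number up to time \<open>k\<close> by \<open>O(k powr (1 - \<nu>))\<close>.
\<close>

section \<open>Almost supermartingales and counts of rare events\<close>

text \<open>Freezing the process when it leaves \<open>A\<close> or passes above \<open>l\<close>
  keeps its mean below \<open>expectation (V 0) + suminf e\<close>. This bound does not depend on
  \<open>l\<close>, so Markov's inequality makes the passage probability vanish as \<open>l\<close>
  grows. After the start, integrability is asked for only on the event of the past, so
  \<open>V\<close> itself may lack a mean.\<close>

lemma (in prob_space) AE_bounded_of_almost_supermartingale:
  fixes V :: "nat \<Rightarrow> 'a \<Rightarrow> real" and A :: "nat \<Rightarrow> 'a set" and e :: "nat \<Rightarrow> real"
  assumes V_meas[measurable]: "\<And>k. V k \<in> borel_measurable M"
    and V0: "integrable M (V 0)"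
    and nonneg: "\<And>k \<omega>. 0 \<le> V k \<omega>"
    and A_meas[measurable]: "\<And>k. A k \<in> sets M" and A_dec: "decseq A"
    and e: "\<And>k. 0 \<le> e k" "summable e"
    and int: "\<And>k l. 0 < l \<Longrightarrow>
       integrable M (\<lambda>\<omega>. indicator {\<omega>\<in>A k. \<forall>t\<le>k. V t \<omega> < l} \<omega> * V (Suc k) \<omega>)"
    and step: "\<And>k l. 0 < l \<Longrightarrow>
       (\<integral>\<omega>. indicator {\<omega>\<in>A k. \<forall>t\<le>k. V t \<omega> < l} \<omega> * V (Suc k) \<omega> \<partial>M)
       \<le> (\<integral>\<omega>. indicator {\<omega>\<in>A k. \<forall>t\<le>k. V t \<omega> < l} \<omega> * V k \<omega> \<partial>M) + e k"
  shows "AE \<omega> in M. (\<forall>k. \<omega> \<in> A k) \<longrightarrow> bdd_above (range (\<lambda>k. V k \<omega>))"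
proof -
  define K where "K = expectation (V 0) + suminf e"
  have tail: "prob {\<omega>\<in>space M. (\<forall>k. \<omega> \<in> A k) \<and> (\<exists>t\<le>k. l \<le> V t \<omega>)} \<le> K / l" if l: "0 < l" for l k
  proof -
    define B where "B = (\<lambda>k. {\<omega>\<in>A k. \<forall>t\<le>k. V t \<omega> < l})"
    have B_space: "B k \<subseteq> space M" for k
      using sets.sets_into_space[OF A_meas[of k]] by (auto simp: B_def)
    have "B k = A k \<inter> {\<omega>\<in>space M. \<forall>t\<le>k. V t \<omega> < l}" for k
      using sets.sets_into_space[OF A_meas[of k]] by (auto simp: B_def)
    then have B_meas[measurable]: "B k \<in> sets M" for k by simp
    have B_dec: "\<omega> \<in> B k" if "\<omega> \<in> B (Suc k)" for \<omega> k
      using that decseq_SucD[OF A_dec, of k] by (auto simp: B_def)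
    \<comment> \<open>the process frozen when it leaves \<open>B\<close>, that is, at its first passage above \<open>l\<close>\<close>
    define S where "S = rec_nat (V 0) (\<lambda>k s \<omega>. if \<omega> \<in> B k then V (Suc k) \<omega> else s \<omega>)"
    have S0: "S 0 = V 0" and S_Suc: "S (Suc k) = (\<lambda>\<omega>. if \<omega> \<in> B k then V (Suc k) \<omega> else S k \<omega>)" for k
      unfolding S_def by simp_all
    have S_B: "S k \<omega> = V k \<omega>" if "\<omega> \<in> B k" for k \<omega>
      using that by (cases k) (auto simp: S0 S_Suc dest: B_dec)
    have S_nonneg: "0 \<le> S k \<omega>" for k \<omega>
      by (induction k) (auto simp: S0 S_Suc nonneg)
    have intB: "integrable M (\<lambda>\<omega>. indicator (B k) \<omega> * V k \<omega>)" for k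
      by (rule integrable_const_bound[of _ l]) (auto simp: nonneg B_def indicator_def less_imp_le l)
    \<comment> \<open>The increment involves \<open>V\<close> only on \<open>B k\<close>, where both
      terms are integrable; integrability and the bound on the mean then pass on by
      induction.\<close>
    have S_eq: "S (Suc k) = (\<lambda>\<omega>. S k \<omega> + indicator (B k) \<omega> * V (Suc k) \<omega> - indicator (B k) \<omega> * V k \<omega>)" for k
      by (rule ext) (simp add: S_Suc S_B indicator_def)
    have intS: "integrable M (S k)" for k
    proof (induction k)
      case 0 then show ?case by (simp add: S0 V0)
    next
      case (Suc k)
      then show ?case unfolding S_eq using int[OF l, of k] intB[of k] by (simp add: B_def)
    qed
    have ES: "expectation (S k) \<le> expectation (V 0) + sum e {..<k}" for k
    proof (induction k)
      case 0 then show ?case by (simp add: S0)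
    next
      case (Suc k)
      have "expectation (S (Suc k)) = expectation (S k) + (\<integral>\<omega>. indicator (B k) \<omega> * V (Suc k) \<omega> \<partial>M)
            - (\<integral>\<omega>. indicator (B k) \<omega> * V k \<omega> \<partial>M)"
        unfolding S_eq using int[OF l, of k] intB[of k] intS[of k] by (simp add: B_def)
      then show ?case using Suc step[OF l, of k] by (simp add: B_def)
    qed
    have ESK: "expectation (S k) \<le> K" for k
      using ES[of k] sum_le_suminf[OF e(2), of "{..<k}"] e(1) by (simp add: K_def)
    \<comment> \<open>On a path that never leaves \<open>A\<close> the process is still running just
      before the first passage \<open>s\<close>, so it is frozen with the value \<open>V s\<close>,
      which is at least \<open>l\<close>.\<close>
    have S_ge: "l \<le> S k \<omega>" if "t \<le> k" "l \<le> V t \<omega>" "\<And>j. \<omega> \<in> A j" for k t \<omega>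
    proof -
      define s where "s = (LEAST t. l \<le> V t \<omega>)"
      have s: "l \<le> V s \<omega>" "s \<le> t" "\<And>r. r < s \<Longrightarrow> V r \<omega> < l"
        unfolding s_def using that(2) by (auto intro: LeastI Least_le dest: not_less_Least)
      have "l \<le> S s \<omega>"
        using s that(3) by (cases s) (auto simp: S0 S_Suc B_def)
      moreover have "S (s + r) \<omega> = S s \<omega>" for r
      proof (induction r)
        case (Suc r)
        have "\<omega> \<notin> B (s + r)" using s(1) by (auto simp: B_def not_less intro!: exI[of _ s])
        then show ?case using Suc by (simp add: S_Suc)
      qed simp
      ultimately show ?thesis using s(2) that(1) by (metis le_add_diff_inverse order_trans)
    qed
    have "prob {\<omega>\<in>space M. (\<forall>k. \<omega> \<in> A k) \<and> (\<exists>t\<le>k. l \<le> V t \<omega>)} \<le> prob {\<omega>\<in>space M. l \<le> S k \<omega>}"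
      using S_ge borel_measurable_integrable[OF intS[of k]] by (intro finite_measure_mono) auto
    also have "\<dots> \<le> expectation (S k) / l"
      by (rule integral_Markov_inequality_measure[OF intS sets.top]) (use l S_nonneg in auto)
    also have "\<dots> \<le> K / l" using ESK[of k] l by (simp add: divide_right_mono)
    finally show ?thesis .
  qed
  \<comment> \<open>\<open>Suc l\<close> keeps the level positive, as \<open>tail\<close> demands.
    The time horizon of \<open>tail\<close> is removed below by continuity of the measure along
    increasing events.\<close>
  define G where "G = (\<lambda>l::nat. {\<omega>\<in>space M. (\<forall>k. \<omega> \<in> A k) \<and> (\<exists>t. real (Suc l) \<le> V t \<omega>)})"
  have G_meas[measurable]: "G l \<in> sets M" for l by (simp add: G_def)
  have G_le: "prob (G l) \<le> K / real (Suc l)" for l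
  proof (rule LIMSEQ_le_const2)
    let ?G = "\<lambda>k. {\<omega>\<in>space M. (\<forall>k. \<omega> \<in> A k) \<and> (\<exists>t\<le>k. real (Suc l) \<le> V t \<omega>)}"
    have "(\<Union>k. ?G k) = G l" by (auto simp: G_def)
    moreover have "(\<lambda>k. prob (?G k)) \<longlonglongrightarrow> prob (\<Union>k. ?G k)"
      by (rule finite_Lim_measure_incseq) (auto simp: incseq_def intro: order_trans)
    ultimately show "(\<lambda>k. prob (?G k)) \<longlonglongrightarrow> prob (G l)" by simp
    show "\<exists>N. \<forall>k\<ge>N. prob (?G k) \<le> K / real (Suc l)" using tail[of "real (Suc l)"] by auto
  qed
  have "prob (\<Inter>l. G l) \<le> K / real (Suc l)" for l
    by (rule order_trans[OF finite_measure_mono G_le]) auto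
  moreover have "(\<lambda>l. K / real (Suc l)) \<longlonglongrightarrow> 0"
    using LIMSEQ_inverse_real_of_nat[THEN tendsto_mult_left, of K] by (simp add: divide_inverse)
  ultimately have "prob (\<Inter>l. G l) \<le> 0" by (intro LIMSEQ_le_const) auto
  then have "prob (\<Inter>l. G l) = 0" by (simp add: measure_le_0_iff)
  then have "AE \<omega> in M. \<omega> \<notin> (\<Inter>l. G l)"
    by (subst (asm) prob_eq_0) auto
  then show ?thesis
  proof (eventually_elim, intro impI)
    fix \<omega> assume "\<omega> \<notin> (\<Inter>l. G l)" and A: "\<forall>k. \<omega> \<in> A k"
    moreover have "\<omega> \<in> space M" using A sets.sets_into_space[OF A_meas[of 0]] by auto
    ultimately obtain l where "\<forall>t. V t \<omega> < real (Suc l)" by (auto simp: G_def not_le)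
    then show "bdd_above (range (\<lambda>k. V k \<omega>))" by (auto intro!: bdd_aboveI[of _ "real (Suc l)"] less_imp_le)
  qed
qed

text \<open>Comparison with an integral: by the mean value theorem the increments of
  \<open>x powr (1 - q)\<close> dominate \<open>1 - q\<close> times the summands, and they
  telescope.\<close>

lemma sum_powr_neg_le:
  fixes q :: real
  assumes "0 \<le> q" "q < 1"
  shows "(\<Sum>t=1..k. real t powr - q) \<le> real k powr (1 - q) / (1 - q)"
proof (induction k)
  case 0 then show ?case by simp
next
  case (Suc k)
  have *: "(1 - q) * real (Suc k) powr - q \<le> real (Suc k) powr (1 - q) - real k powr (1 - q)"
  \<comment> \<open>The derivative of \<open>powr\<close> is used only at positive arguments, so the
    increment from 0 to 1 is checked directly.\<close>
  proof (cases "k = 0")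
    case True then show ?thesis using assms by simp
  next
    case False
    have "\<exists>z. real k < z \<and> z < real (Suc k) \<and> real (Suc k) powr (1 - q) - real k powr (1 - q)
        = (real (Suc k) - real k) * ((1 - q) * z powr - q)"
    proof (rule MVT2)
      fix x assume "real k \<le> x"
      then have "0 < x" using False by linarith
      from has_real_derivative_powr[OF this, of "1 - q"]
      show "((\<lambda>x. x powr (1 - q)) has_real_derivative (1 - q) * x powr - q) (at x)"
        by simp
    qed simp
    then obtain z where z: "real k < z" "z < real (Suc k)"
      "real (Suc k) powr (1 - q) - real k powr (1 - q) = (1 - q) * z powr - q" by auto
    have "real (Suc k) powr - q \<le> z powr - q"
      using z assms False by (intro powr_mono2') auto
    then show ?thesis using z assms by (simp add: mult_left_mono)
  qed
  then have "real (Suc k) powr - q \<le> (real (Suc k) powr (1 - q) - real k powr (1 - q)) / (1 - q)"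
    using assms by (simp add: field_simps)
  then show ?case using Suc by (simp add: diff_divide_distrib)
qed

text \<open>Pairwise independence makes the variance of the count at most the sum of the
  probabilities, which is of order \<open>k powr (1 - q)\<close>. At \<open>k = 2 ^ j\<close> the
  Chebyshev bound is therefore geometric in \<open>j\<close>, so Borel-Cantelli applies;
  monotonicity of the count covers the times between powers of two.\<close>

lemma (in prob_space) AE_count_pairwise_independent_events:
  fixes Q :: "nat \<Rightarrow> 'a set" and q K :: real
  assumes Q[measurable]: "\<And>t. 1 \<le> t \<Longrightarrow> Q t \<in> events"
    and indep: "\<And>s t. 1 \<le> s \<Longrightarrow> 1 \<le> t \<Longrightarrow> s \<noteq> t \<Longrightarrow> prob (Q s \<inter> Q t) = prob (Q s) * prob (Q t)"
    and q: "0 \<le> q" "q < 1"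
    and le: "\<And>t. 1 \<le> t \<Longrightarrow> prob (Q t) \<le> K * real t powr - q"
  shows "AE \<omega> in M. \<exists>C. \<forall>k\<ge>1. (\<Sum>t=1..k. indicator (Q t) \<omega>) \<le> C * real k powr (1 - q)"
proof -
  define S where "S = (\<lambda>k \<omega>. \<Sum>t=1..k. indicat_real (Q t) \<omega>)"
  have K: "0 \<le> K" using le[of 1] measure_nonneg[of M "Q 1"] by (simp del: measure_nonneg)
  define L where "L = K / (1 - q)"
  have L: "0 \<le> L" using K q by (simp add: L_def)
  have intI: "integrable M (\<lambda>\<omega>. indicat_real (Q t) \<omega>)" if "1 \<le> t" for t
    using Q[OF that] by (intro integrable_real_indicator) (auto simp: emeasure_eq_measure)
  have intS: "integrable M (S k)" for k unfolding S_def by (intro Bochner_Integration.integrable_sum intI) auto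
  have mean: "expectation (S k) = (\<Sum>t=1..k. prob (Q t))" for k
    unfolding S_def by (subst Bochner_Integration.integral_sum) (auto intro: intI)
  have sumP: "(\<Sum>t=1..k. prob (Q t)) \<le> L * real k powr (1 - q)" for k
  proof -
    have "(\<Sum>t=1..k. prob (Q t)) \<le> (\<Sum>t=1..k. K * real t powr - q)" by (intro sum_mono le) auto
    also have "\<dots> = K * (\<Sum>t=1..k. real t powr - q)" by (simp add: sum_distrib_left)
    also have "\<dots> \<le> K * (real k powr (1 - q) / (1 - q))" by (intro mult_left_mono sum_powr_neg_le q K)
    finally show ?thesis by (simp add: L_def)
  qed
  have S2: "(S k \<omega>)\<^sup>2 = (\<Sum>s=1..k. \<Sum>t=1..k. indicat_real (Q s \<inter> Q t) \<omega>)" for k \<omega>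
    by (simp add: S_def power2_eq_square sum_product indicator_inter_arith)
  have intS2: "integrable M (\<lambda>\<omega>. (S k \<omega>)\<^sup>2)" for k
    unfolding S2 by (intro Bochner_Integration.integrable_sum) (auto intro!: integrable_real_indicator simp: emeasure_eq_measure)
  have ES2: "expectation (\<lambda>\<omega>. (S k \<omega>)\<^sup>2) = (\<Sum>s=1..k. \<Sum>t=1..k. prob (Q s \<inter> Q t))" for k
    unfolding S2 by (subst Bochner_Integration.integral_sum, (auto intro!: Bochner_Integration.integrable_sum sum.cong integrable_real_indicator simp: emeasure_eq_measure)[1])
       (auto intro!: sum.cong simp: Bochner_Integration.integral_sum emeasure_eq_measure Sigma_Algebra.sets.Int Q)
  have var: "variance (S k) \<le> L * real k powr (1 - q)" for k
  proof -
    have "variance (S k) = expectation (\<lambda>\<omega>. (S k \<omega>)\<^sup>2) - (expectation (S k))\<^sup>2"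
      by (rule variance_eq[OF intS intS2])
    also have "\<dots> = (\<Sum>s=1..k. \<Sum>t=1..k. prob (Q s \<inter> Q t) - prob (Q s) * prob (Q t))"
      unfolding ES2 mean by (simp add: power2_eq_square sum_product sum_subtractf)
    \<comment> \<open>Off the diagonal the covariance vanishes; on it, the subtracted square is
      dropped.\<close>
    also have "\<dots> \<le> (\<Sum>s=1..k. \<Sum>t=1..k. if t = s then prob (Q s) else 0)"
      using indep by (intro sum_mono) auto
    also have "\<dots> = (\<Sum>s=1..k. prob (Q s))" by (simp add: sum.delta)
    finally show ?thesis using sumP[of k] by simp
  qed
  define Bad where "Bad = (\<lambda>j::nat. {\<omega>\<in>space M. real (2 ^ j) powr (1 - q) \<le> \<bar>S (2 ^ j) \<omega> - expectation (S (2 ^ j))\<bar>})"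
  have S_meas[measurable]: "S k \<in> borel_measurable M" for k using intS by auto
  define g where "g = 2 powr - (1 - q)"
  \<comment> \<open>This is where \<open>q < 1\<close> makes the failure probabilities
    summable.\<close>
  have g: "0 < g" "g < 1" using q powr_less_mono[of "-(1-q)" 0 "2::real"] by (auto simp: g_def)
  have p2: "real (2 ^ j) powr - (1 - q) = g ^ j" for j :: nat
    by (simp add: g_def powr_realpow[symmetric] powr_powr mult.commute)
  have BadP: "prob (Bad j) \<le> L * g ^ j" for j
  proof -
    let ?y = "real (2 ^ j) powr (1 - q)"
    have y: "0 < ?y" by simp
    have "prob (Bad j) \<le> variance (S (2 ^ j)) / ?y\<^sup>2"
      unfolding Bad_def by (rule Chebyshev_inequality[OF S_meas intS2 y])
    also have "\<dots> \<le> L * ?y / ?y\<^sup>2" by (intro divide_right_mono var) auto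
    also have "\<dots> = L * real (2 ^ j) powr - (1 - q)"
      unfolding powr_minus by (simp add: power2_eq_square divide_inverse)
    finally show ?thesis unfolding p2 .
  qed
  have "AE \<omega> in M. eventually (\<lambda>j. \<omega> \<in> space M - Bad j) sequentially"
  proof (rule borel_cantelli_AE1)
    show "Bad j \<in> sets M" for j by (simp add: Bad_def)
    show "emeasure M (Bad j) < \<infinity>" for j by (simp add: emeasure_eq_measure)
    show "summable (\<lambda>j. measure M (Bad j))"
      by (rule summable_comparison_test'[of "\<lambda>j. L * g ^ j" 0])
         (use BadP g in \<open>auto intro!: summable_mult summable_geometric\<close>)
  qed
  then show ?thesis
  proof eventually_elim
    fix \<omega> assume "eventually (\<lambda>j. \<omega> \<in> space M - Bad j) sequentially"
    then obtain J where J: "\<And>j. J \<le> j \<Longrightarrow> \<omega> \<in> space M - Bad j" by (auto simp: eventually_sequentially)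
    have large: "S (2 ^ j) \<omega> \<le> (L + 1) * real (2 ^ j) powr (1 - q)" if "J \<le> j" for j
      using J[OF that] sumP[of "2 ^ j"] unfolding Bad_def mean by (auto simp: algebra_simps)
    have mono: "S k \<omega> \<le> S k' \<omega>" if "k \<le> k'" for k k'
      unfolding S_def by (intro sum_mono2) (use that in auto)
    \<comment> \<open>The factor \<open>2 powr (1 - q)\<close> pays for rounding \<open>k\<close> up
      to the next power of two; the summand \<open>S (2 ^ J) \<omega>\<close> covers all
      \<open>k\<close> up to \<open>2 ^ J\<close>.\<close>
    define C where "C = (L + 1) * 2 powr (1 - q) + S (2 ^ J) \<omega>"
    have C0: "0 \<le> S (2 ^ J) \<omega>" unfolding S_def by (intro sum_nonneg) auto
    have "S k \<omega> \<le> C * real k powr (1 - q)" if k: "1 \<le> k" for k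
    proof (cases "k \<le> 2 ^ J")
      case True
      have "1 \<le> real k powr (1 - q)" using k q by (intro ge_one_powr_ge_zero) auto
      then have "S (2 ^ J) \<omega> * 1 \<le> C * real k powr (1 - q)"
        using C0 L by (intro mult_mono) (auto simp: C_def)
      then show ?thesis using mono[OF True] by simp
    next
      case False
      obtain j where j: "2 ^ j \<le> k" "k < 2 ^ (j + 1)" using ex_power_ivl1[of 2 k] k by auto
      have "J \<le> j"
      proof (rule ccontr)
        assume "\<not> J \<le> j"
        then have "(2::nat) ^ (j + 1) \<le> 2 ^ J" by (intro power_increasing) auto
        then show False using j False by linarith
      qed
      have "S k \<omega> \<le> S (2 ^ (j + 1)) \<omega>" using j by (intro mono) auto
      also have "\<dots> \<le> (L + 1) * real (2 ^ (j + 1)) powr (1 - q)" using \<open>J \<le> j\<close> by (intro large) auto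
      also have "\<dots> \<le> (L + 1) * (2 * real k) powr (1 - q)"
      proof -
        have "real (2 ^ (j + 1)) \<le> 2 * real k" using j(1) of_nat_mono[of "2 ^ j" k, where 'a=real] by simp
        then show ?thesis using L q by (intro mult_left_mono powr_mono2) auto
      qed
      also have "\<dots> = (L + 1) * 2 powr (1 - q) * real k powr (1 - q)" by (simp add: powr_mult)
      also have "\<dots> \<le> C * real k powr (1 - q)" using C0 by (intro mult_right_mono) (auto simp: C_def)
      finally show ?thesis .
    qed
    then show "\<exists>C. \<forall>k\<ge>1. (\<Sum>t=1..k. indicator (Q t) \<omega>) \<le> C * real k powr (1 - q)"
      unfolding S_def by blast
  qed
qed

section \<open>The Laplace distribution\<close>

definition laplace :: "real measure" where
  "laplace = density lborel (\<lambda>x. ennreal (exp (- \<bar>x\<bar>) / 2))"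

lemma space_laplace[simp]: "space laplace = UNIV" and sets_laplace[simp, measurable_cong]: "sets laplace = sets borel"
  by (simp_all add: laplace_def)

lemma emeasure_laplace_atLeast:
  assumes "0 \<le> u"
  shows "emeasure laplace {u..} = ennreal (exp (- u) / 2)"
proof -
  have "emeasure laplace {u..} = (\<integral>\<^sup>+x. ennreal (exp (- x) / 2) * indicator {u..} x \<partial>lborel)"
    using assms by (auto simp: laplace_def emeasure_density intro!: nn_integral_cong split: split_indicator)
  also have "\<dots> = ennreal (0 - (- exp (- u) / 2))"
  proof (rule nn_integral_FTC_atLeast)
    show "((\<lambda>x. - exp (- x) / 2) has_real_derivative exp (- x) / 2) (at x)" for x :: real
      by (auto intro!: derivative_eq_intros)
    have "((\<lambda>x::real. - exp (- x) / 2) \<longlongrightarrow> - 0 / 2) at_top"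
      by (intro tendsto_intros filterlim_compose[OF exp_at_bot] filterlim_uminus_at_bot_at_top) auto
    then show "((\<lambda>x::real. - exp (- x) / 2) \<longlongrightarrow> 0) at_top" by simp
  qed auto
  finally show ?thesis by simp
qed

lemma emeasure_laplace_singleton: "emeasure laplace {u} = 0"
proof -
  have "absolutely_continuous lborel laplace"
    unfolding laplace_def by (rule absolutely_continuousI_density) auto
  moreover have "{u} \<in> null_sets lborel" by (auto simp: null_sets_def)
  ultimately show ?thesis by (auto simp: absolutely_continuous_def)
qed

text \<open>The density is even. By reflection only the right tail, where the density is a plain
  exponential, has to be integrated.\<close>

lemma emeasure_laplace_uminus: "A \<in> sets borel \<Longrightarrow> emeasure laplace (uminus ` A) = emeasure laplace A"
proof -
  assume A[measurable]: "A \<in> sets borel"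
  have im: "uminus ` A = {x::real. - x \<in> A}" by (auto simp: image_iff) (metis minus_minus)
  then have [measurable]: "uminus ` A \<in> sets borel" by simp
  have "emeasure laplace (uminus ` A) = (\<integral>\<^sup>+x. ennreal (exp (- \<bar>x\<bar>) / 2) * indicator (uminus ` A) x \<partial>lborel)"
    by (simp add: laplace_def emeasure_density)
  also have "\<dots> = (\<integral>\<^sup>+x. ennreal (exp (- \<bar>x\<bar>) / 2) * indicator A x \<partial>lborel)"
    by (subst nn_integral_real_affine[where c="-1" and t=0])
       (auto intro!: nn_integral_cong simp: im indicator_def)
  also have "\<dots> = emeasure laplace A" by (simp add: laplace_def emeasure_density)
  finally show ?thesis .
qed

lemma emeasure_laplace_greaterThan:
  assumes "0 \<le> u" shows "emeasure laplace {u<..} = ennreal (exp (- u) / 2)"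
proof -
  have "{u..} = {u<..} \<union> {u}" by auto
  then have "emeasure laplace {u..} = emeasure laplace {u<..} + emeasure laplace {u}"
    by (simp add: plus_emeasure)
  then show ?thesis using assms by (simp add: emeasure_laplace_atLeast emeasure_laplace_singleton)
qed

lemma prob_space_laplace: "prob_space laplace"
proof
  have "emeasure laplace (space laplace) = emeasure laplace (uminus ` {0<..} \<union> {0..})"
    by (rule arg_cong[where f="emeasure laplace"]) auto
  also have "\<dots> = emeasure laplace (uminus ` {0<..}) + emeasure laplace {0..}"
    by (intro plus_emeasure[symmetric]) auto
  also have "\<dots> = ennreal (1/2) + ennreal (1/2)"
    using emeasure_laplace_uminus[of "{0<..}"] emeasure_laplace_greaterThan[of 0] emeasure_laplace_atLeast[of 0]
    by simp
  also have "\<dots> = 1" by (subst ennreal_plus[symmetric]) auto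
  finally show "emeasure laplace (space laplace) = 1" .
qed

lemma measure_laplace_greaterThan: "measure laplace {u<..} = lapF (- u)"
proof (cases "0 \<le> u")
  case True
  then show ?thesis using emeasure_laplace_greaterThan[OF True] by (auto simp: measure_def lapF_def)
next
  case False
  interpret prob_space laplace by (rule prob_space_laplace)
  have "{u<..} = space laplace - uminus ` {-u..}" by (auto simp: not_le)
  moreover have "uminus ` {-u..} = {..u}" by auto
  ultimately have "measure laplace {u<..} = 1 - measure laplace (uminus ` {-u..})"
    using prob_compl[of "uminus ` {-u..}"] by simp
  also have "measure laplace (uminus ` {-u..}) = exp u / 2"
    using False emeasure_laplace_uminus[of "{-u..}"] emeasure_laplace_atLeast[of "-u"] by (simp add: measure_def)
  finally show ?thesis using False by (simp add: lapF_def)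
qed

lemma measure_laplace_lessThan: "measure laplace {..<u} = lapF u"
proof -
  have "uminus ` {-u<..} = {..<u}" by auto
  then show ?thesis
    using emeasure_laplace_uminus[of "{-u<..}"] measure_laplace_greaterThan[of "-u"] by (simp add: measure_def)
qed

text \<open>Each of the two tails contributes half of the bound. For negative \<open>c\<close> the
  bound exceeds 1; this case does occur, since the threshold \<open>nu ln t - R / b\<close> may be
  negative for small \<open>t\<close>.\<close>

lemma measure_laplace_abs_greater_le: "measure laplace {u. c < \<bar>u\<bar>} \<le> exp (- c)"
proof -
  interpret prob_space laplace by (rule prob_space_laplace)
  show ?thesis
  proof (cases "0 \<le> c")
    case True
    have "{u. c < \<bar>u\<bar>} = {c<..} \<union> {..<- c}" by auto
    then have "measure laplace {u. c < \<bar>u\<bar>} \<le> measure laplace {c<..} + measure laplace {..<- c}"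
      by (simp add: measure_Un_le)
    also have "\<dots> = 2 * lapF (- c)" by (simp add: measure_laplace_greaterThan measure_laplace_lessThan)
    also have "\<dots> = exp (- c)" using True by (auto simp: lapF_def)
    finally show ?thesis .
  next
    case False
    then show ?thesis by (intro order_trans[OF prob_le_1[of "{u. c < \<bar>u\<bar>}"]]) simp
  qed
qed

section \<open>Monotonicity, bounds and measurability of F, G and the messages\<close>

lemma lapF_neg_le: "x < 0 \<Longrightarrow> lapF x \<le> 1 / 2" and lapF_nonneg_ge: "\<not> x < 0 \<Longrightarrow> 1 / 2 \<le> lapF x"
  by (simp_all add: lapF_def)

lemma lapF_mono: "x \<le> y \<Longrightarrow> lapF x \<le> lapF y"
proof (cases "x < 0 \<and> \<not> y < 0")
  case True
  then show ?thesis using lapF_neg_le[of x] lapF_nonneg_ge[of y] by linarith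
qed (auto simp: lapF_def)

lemma lapF_bounds: "0 \<le> lapF x" "lapF x \<le> 1"
proof -
  show "0 \<le> lapF x" by (cases "x < 0") (simp add: lapF_def, use lapF_nonneg_ge[of x] in linarith)
  show "lapF x \<le> 1" by (cases "x < 0") (use lapF_neg_le[of x] in linarith, simp add: lapF_def)
qed

lemma lapF_measurable[measurable]: "lapF \<in> borel_measurable borel"
  unfolding lapF_def[abs_def] by measurable

lemma Gfun_measurable[measurable]: "Gfun nu b i j k \<in> borel_measurable borel"
  unfolding Gfun_def[abs_def] by measurable

lemma shat_measurable[measurable]:
  "(\<lambda>(x, u). shat nu b j i k x u) \<in> borel_measurable (borel \<Otimes>\<^sub>M borel)"
  unfolding shat_def by measurable

lemma Gfun_mono: "0 < b i j \<Longrightarrow> x \<le> y \<Longrightarrow> Gfun nu b i j k x \<le> Gfun nu b i j k y"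
  unfolding Gfun_def by (intro diff_mono lapF_mono divide_right_mono) auto

text \<open>The indices of the message and of \<open>Gfun\<close> are unrelated, because they are
  reversed in the consensus term and equal in the dither noise.\<close>

lemma abs_shat_diff_Gfun_le: "\<bar>shat nu b j i k x u - Gfun nu' b' i' j' k' y\<bar> \<le> 2"
proof -
  have "\<bar>shat nu b j i k x u\<bar> \<le> 1" by (auto simp: shat_def)
  moreover have "\<bar>Gfun nu' b' i' j' k' y\<bar> \<le> 1"
    using lapF_bounds[of "(y - Cthr nu' b' i' j' k') / b' i' j'"] lapF_bounds[of "(- y - Cthr nu' b' i' j' k') / b' i' j'"]
    by (auto simp: Gfun_def)
  ultimately show ?thesis by linarith
qed

text \<open>The message is a difference of indicators of two half lines in the dither, one beyond
  each threshold; \<open>C\<close> identifies the nonnegative threshold that keeps them disjoint.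
  Averaging over the dither therefore gives exactly \<open>Gfun\<close> at the state of the sender,
  which is the right quantity for centring the message.\<close>

lemma integral_laplace_shat:
  assumes b: "0 < b j i" and C: "0 \<le> Cthr nu b j i k"
  shows "integrable laplace (\<lambda>u. shat nu b j i k x u)"
    and "(\<integral>u. shat nu b j i k x u \<partial>laplace) = Gfun nu b j i k x"
proof -
  interpret prob_space laplace by (rule prob_space_laplace)
  let ?C = "Cthr nu b j i k"
  have eq: "(\<lambda>u. shat nu b j i k x u)
      = (\<lambda>u. indicat_real {(?C - x) / b j i <..} u - indicat_real {..< (- x - ?C) / b j i} u)"
  proof
    fix u
    have "x + b j i * u > ?C \<longleftrightarrow> (?C - x) / b j i < u" "x + b j i * u < - ?C \<longleftrightarrow> u < (- x - ?C) / b j i"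
      using b by (auto simp: field_simps)
    then show "shat nu b j i k x u = indicat_real {(?C - x) / b j i <..} u - indicat_real {..< (- x - ?C) / b j i} u"
      using C by (auto simp: shat_def indicator_def)
  qed
  have int: "integrable laplace (indicat_real {(?C - x) / b j i <..})" "integrable laplace (indicat_real {..< (- x - ?C) / b j i})"
    by (intro integrable_real_indicator; simp add: emeasure_eq_measure)+
  show "integrable laplace (\<lambda>u. shat nu b j i k x u)" unfolding eq using int by simp
  have "- ((?C - x) / b j i) = (x - ?C) / b j i" unfolding minus_divide_left by simp
  then show "(\<integral>u. shat nu b j i k x u \<partial>laplace) = Gfun nu b j i k x"
    unfolding eq using int by (simp add: measure_laplace_greaterThan measure_laplace_lessThan Gfun_def)
qed

section \<open>Independence and generated sigma-algebras\<close>

text \<open>The product rule for preimages identifies the joint law of \<open>X\<close> and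
  \<open>Y\<close> as a product measure, and Fubini integrates over \<open>Y\<close> first.
  Independence is stated for preimages because it will be read off from independent
  sigma-algebras.\<close>

lemma (in prob_space) expectation_indep_eq_0:
  fixes f :: "'b \<times> 'c \<Rightarrow> real"
  assumes [measurable]: "X \<in> M \<rightarrow>\<^sub>M S" "Y \<in> M \<rightarrow>\<^sub>M T"
    and ind: "\<And>A B. A \<in> sets S \<Longrightarrow> B \<in> sets T \<Longrightarrow>
      prob ((X -` A \<inter> space M) \<inter> (Y -` B \<inter> space M)) = prob (X -` A \<inter> space M) * prob (Y -` B \<inter> space M)"
    and f[measurable]: "f \<in> borel_measurable (S \<Otimes>\<^sub>M T)"
    and int: "integrable M (\<lambda>\<omega>. f (X \<omega>, Y \<omega>))"
    and zero: "\<And>x. (\<integral>y. f (x, y) \<partial>distr M T Y) = 0"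
  shows "expectation (\<lambda>\<omega>. f (X \<omega>, Y \<omega>)) = 0"
proof -
  interpret X: prob_space "distr M S X" by (rule prob_space_distr) simp
  interpret Y: prob_space "distr M T Y" by (rule prob_space_distr) simp
  interpret XY: pair_prob_space "distr M S X" "distr M T Y" ..
  have eq: "distr M S X \<Otimes>\<^sub>M distr M T Y = distr M (S \<Otimes>\<^sub>M T) (\<lambda>x. (X x, Y x))"
  proof (rule pair_measure_eqI)
    fix A B assume A[measurable]: "A \<in> sets (distr M S X)" and B[measurable]: "B \<in> sets (distr M T Y)"
    have "(\<lambda>x. (X x, Y x)) -` (A \<times> B) \<inter> space M = (X -` A \<inter> space M) \<inter> (Y -` B \<inter> space M)" by auto
    then show "emeasure (distr M S X) A * emeasure (distr M T Y) B
        = emeasure (distr M (S \<Otimes>\<^sub>M T) (\<lambda>x. (X x, Y x))) (A \<times> B)"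
      using A B by (simp add: emeasure_distr emeasure_eq_measure ind ennreal_mult')
  qed (simp_all add: X.sigma_finite_measure_axioms Y.sigma_finite_measure_axioms)
  have "expectation (\<lambda>\<omega>. f (X \<omega>, Y \<omega>)) = integral\<^sup>L (distr M S X \<Otimes>\<^sub>M distr M T Y) f"
    unfolding eq by (subst integral_distr) auto
  also have "\<dots> = (\<integral>x. \<integral>y. f (x, y) \<partial>distr M T Y \<partial>distr M S X)"
  proof (rule XY.integral_fst'[symmetric])
    show "integrable (distr M S X \<Otimes>\<^sub>M distr M T Y) f"
      unfolding eq using int by (subst integrable_distr_eq) auto
  qed
  finally show ?thesis by (simp add: zero)
qed

section \<open>Sigma-algebras generated by families of random variables\<close>

lemma space_gen_alg[simp]: "space (gen_alg M fs) = space M"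
  and sets_gen_alg: "sets (gen_alg M fs) = gen_sets M fs"
proof -
  have "(\<Union>f\<in>fs. {f -` B \<inter> space M | B. B \<in> sets borel}) \<subseteq> Pow (space M)" by auto
  then show "space (gen_alg M fs) = space M" "sets (gen_alg M fs) = gen_sets M fs"
    by (simp_all add: gen_alg_def gen_sets_def space_measure_of sets_measure_of)
qed

lemma gen_alg_measurable: "f \<in> fs \<Longrightarrow> f \<in> borel_measurable (gen_alg M fs)"
  by (rule measurableI) (auto simp: sets_gen_alg gen_sets_def)

lemma gen_sets_subset_events:
  assumes "\<And>f. f \<in> fs \<Longrightarrow> f \<in> borel_measurable M"
  shows "gen_sets M fs \<subseteq> sets M"
  unfolding gen_sets_def using measurable_sets[OF assms] by (intro sets.sigma_sets_subset) auto

lemma subalgebra_gen_alg: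
  assumes "\<And>f. f \<in> fs \<Longrightarrow> f \<in> borel_measurable M"
  shows "subalgebra M (gen_alg M fs)"
  using gen_sets_subset_events[OF assms] by (simp add: subalgebra_def sets_gen_alg)

lemma gen_sets_mono: "fs \<subseteq> gs \<Longrightarrow> gen_sets M fs \<subseteq> gen_sets M gs"
  unfolding gen_sets_def by (intro sigma_sets_mono') auto

lemma subalgebra_gen_alg_mono: "fs \<subseteq> gs \<Longrightarrow> subalgebra (gen_alg M gs) (gen_alg M fs)"
  by (simp add: subalgebra_def sets_gen_alg gen_sets_mono)

section \<open>The one-step inequality\<close>

text \<open>Cauchy-Schwarz in each row. The free constant \<open>P\<close> allows one bound to serve
  a matrix, its transpose and all sensors.\<close>

lemma sum_matvec_sq_le:
  fixes A :: "nat \<Rightarrow> nat \<Rightarrow> real"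
  assumes h: "\<And>r c. r < m \<Longrightarrow> c < n \<Longrightarrow> \<bar>A r c\<bar> \<le> h" and P: "real n * real m * h\<^sup>2 \<le> P"
  shows "(\<Sum>r<m. (\<Sum>c<n. A r c * v c)\<^sup>2) \<le> P * (\<Sum>c<n. (v c)\<^sup>2)"
proof -
  have "(\<Sum>c<n. A r c * v c)\<^sup>2 \<le> real n * h\<^sup>2 * (\<Sum>c<n. (v c)\<^sup>2)" if "r < m" for r
  proof -
    have "(\<Sum>c<n. A r c * v c)\<^sup>2 \<le> (\<Sum>c<n. (A r c)\<^sup>2) * (\<Sum>c<n. (v c)\<^sup>2)"
      by (rule Cauchy_Schwarz_ineq_sum)
    also have "(\<Sum>c<n. (A r c)\<^sup>2) \<le> (\<Sum>c<n. h\<^sup>2)"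
      by (intro sum_mono abs_le_square_iff[THEN iffD1]) (use h[OF that] in fastforce)
    then have "(\<Sum>c<n. (A r c)\<^sup>2) * (\<Sum>c<n. (v c)\<^sup>2) \<le> real n * h\<^sup>2 * (\<Sum>c<n. (v c)\<^sup>2)"
      by (intro mult_right_mono) (auto intro: sum_nonneg)
    finally show ?thesis .
  qed
  then have "(\<Sum>r<m. (\<Sum>c<n. A r c * v c)\<^sup>2) \<le> (\<Sum>r<m. real n * h\<^sup>2 * (\<Sum>c<n. (v c)\<^sup>2))"
    by (intro sum_mono) auto
  also have "\<dots> = (real n * real m * h\<^sup>2) * (\<Sum>c<n. (v c)\<^sup>2)" by simp
  also have "\<dots> \<le> P * (\<Sum>c<n. (v c)\<^sup>2)" by (intro mult_right_mono P sum_nonneg) auto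
  finally show ?thesis .
qed

text \<open>In the expanded square the terms linear in \<open>D\<close> and \<open>u\<close> are
  kept exactly, because they are to be averaged later; only the square of the whole increment is
  estimated.\<close>

lemma sensor_update_sq_le:
  fixes A :: "nat \<Rightarrow> nat \<Rightarrow> real" and e u :: "nat \<Rightarrow> real"
  assumes l: "l < n" and \<beta>: "0 \<le> \<beta>"
    and h: "\<And>r c. r < m \<Longrightarrow> c < n \<Longrightarrow> \<bar>A r c\<bar> \<le> h" and P: "real n * real m * h\<^sup>2 \<le> P"
  shows "(\<Sum>c<n. (e c + (if c = l then D else 0) + \<beta> * (\<Sum>r<m. A r c * (u r - (\<Sum>c'<n. A r c' * e c'))))\<^sup>2)
    \<le> (1 + 3 * \<beta>\<^sup>2 * P\<^sup>2) * (\<Sum>c<n. (e c)\<^sup>2) + 2 * (e l * D) + 2 * (\<beta> * (\<Sum>c<n. e c * (\<Sum>r<m. A r c * u r)))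
      + 3 * D\<^sup>2 + 3 * P * (\<beta>\<^sup>2 * (\<Sum>r<m. (u r)\<^sup>2))"
proof -
  have P0: "0 \<le> P" by (rule order_trans[OF _ P]) auto
  \<comment> \<open>With \<open>A\<close> read as a matrix, \<open>g\<close> is its transpose
    applied to \<open>u\<close> and \<open>f\<close> its transpose applied to \<open>A e\<close>.
    Hence the inner product of \<open>e\<close> and \<open>f\<close> is the squared norm of
    \<open>A e\<close>.\<close>
  define g where "g = (\<lambda>c. \<Sum>r<m. A r c * u r)"
  define v where "v = (\<lambda>r. \<Sum>c<n. A r c * e c)"
  define f where "f = (\<lambda>c. \<Sum>r<m. A r c * v r)"
  define \<delta> where "\<delta> = (\<lambda>c. if c = l then D else 0)"
  have hT: "\<And>c r. c < n \<Longrightarrow> r < m \<Longrightarrow> \<bar>A r c\<bar> \<le> h" using h by blast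
  have PT: "real m * real n * h\<^sup>2 \<le> P" using P by (simp add: mult.commute)
  have pt: "(e c + \<delta> c + \<beta> * (g c - f c))\<^sup>2 \<le> (e c)\<^sup>2 + 2 * (e c * \<delta> c) + 2 * (\<beta> * (e c * g c)) - 2 * \<beta> * (e c * f c)
      + 3 * (\<delta> c)\<^sup>2 + 3 * (\<beta>\<^sup>2 * (g c)\<^sup>2) + 3 * \<beta>\<^sup>2 * (f c)\<^sup>2" for c
  proof -
    \<comment> \<open>The difference of the two sides is the sum of the three squares supplied as
      facts.\<close>
    have *: "(x + y - z)\<^sup>2 \<le> 3 * x\<^sup>2 + 3 * y\<^sup>2 + 3 * z\<^sup>2" for x y z :: real
      using zero_le_power2[of "x - y"] zero_le_power2[of "x + z"] zero_le_power2[of "y + z"]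
      by (simp add: power2_eq_square algebra_simps)
    have "(e c + \<delta> c + \<beta> * (g c - f c))\<^sup>2 = (e c)\<^sup>2 + 2 * (e c * \<delta> c) + 2 * (\<beta> * (e c * g c)) - 2 * \<beta> * (e c * f c)
        + (\<delta> c + \<beta> * g c - \<beta> * f c)\<^sup>2"
      by (simp add: power2_eq_square algebra_simps)
    then show ?thesis using *[of "\<delta> c" "\<beta> * g c" "\<beta> * f c"] by (simp add: power_mult_distrib)
  qed
  have "(\<Sum>c<n. e c * \<delta> c) = e l * D" "(\<Sum>c<n. (\<delta> c)\<^sup>2) = D\<^sup>2"
    using l by (simp_all add: \<delta>_def if_distrib[where f="\<lambda>x. _ * x"] if_distrib[where f="\<lambda>x. x\<^sup>2"] sum.delta cong: if_cong)
  moreover have "(\<Sum>c<n. e c * f c) = (\<Sum>r<m. (v r)\<^sup>2)"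
  proof -
    have "(\<Sum>c<n. e c * f c) = (\<Sum>c<n. \<Sum>r<m. (A r c * e c) * v r)"
      by (simp add: f_def sum_distrib_left mult_ac)
    also have "\<dots> = (\<Sum>r<m. (\<Sum>c<n. A r c * e c) * v r)"
      by (subst sum.swap) (simp add: sum_distrib_right)
    finally show ?thesis by (simp add: v_def power2_eq_square)
  qed
  moreover have "(\<Sum>c<n. (g c)\<^sup>2) \<le> P * (\<Sum>r<m. (u r)\<^sup>2)"
    unfolding g_def by (rule sum_matvec_sq_le[OF hT PT])
  moreover have "(\<Sum>c<n. (f c)\<^sup>2) \<le> P\<^sup>2 * (\<Sum>c<n. (e c)\<^sup>2)"
  proof -
    have "(\<Sum>c<n. (f c)\<^sup>2) \<le> P * (\<Sum>r<m. (v r)\<^sup>2)"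
      unfolding f_def by (rule sum_matvec_sq_le[OF hT PT])
    also have "\<dots> \<le> P * (P * (\<Sum>c<n. (e c)\<^sup>2))"
      unfolding v_def by (intro mult_left_mono sum_matvec_sq_le[OF h P] P0)
    finally show ?thesis by (simp add: power2_eq_square mult_ac)
  qed
  ultimately have S: "(\<Sum>c<n. (e c)\<^sup>2 + 2 * (e c * \<delta> c) + 2 * (\<beta> * (e c * g c)) - 2 * \<beta> * (e c * f c)
      + 3 * (\<delta> c)\<^sup>2 + 3 * (\<beta>\<^sup>2 * (g c)\<^sup>2) + 3 * \<beta>\<^sup>2 * (f c)\<^sup>2)
    \<le> (\<Sum>c<n. (e c)\<^sup>2) + 2 * (e l * D) + 2 * (\<beta> * (\<Sum>c<n. e c * g c)) - 2 * \<beta> * (\<Sum>r<m. (v r)\<^sup>2)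
      + 3 * D\<^sup>2 + 3 * (\<beta>\<^sup>2 * (P * (\<Sum>r<m. (u r)\<^sup>2))) + 3 * \<beta>\<^sup>2 * (P\<^sup>2 * (\<Sum>c<n. (e c)\<^sup>2))"
    by (simp add: sum.distrib sum_subtractf flip: sum_distrib_left)
       (intro add_mono mult_left_mono; simp)
  \<comment> \<open>The observation matrix enters the cross term with a negative sign, so this
    contribution can be discarded.\<close>
  have "0 \<le> 2 * \<beta> * (\<Sum>r<m. (v r)\<^sup>2)" using \<beta> by (intro mult_nonneg_nonneg sum_nonneg) auto
  moreover have "(\<Sum>c<n. (e c + (if c = l then D else 0) + \<beta> * (\<Sum>r<m. A r c * (u r - (\<Sum>c'<n. A r c' * e c'))))\<^sup>2)
      = (\<Sum>c<n. (e c + \<delta> c + \<beta> * (g c - f c))\<^sup>2)"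
    by (simp add: \<delta>_def g_def f_def v_def right_diff_distrib sum_subtractf)
  moreover have "\<dots> \<le> (\<Sum>c<n. (e c)\<^sup>2 + 2 * (e c * \<delta> c) + 2 * (\<beta> * (e c * g c)) - 2 * \<beta> * (e c * f c)
      + 3 * (\<delta> c)\<^sup>2 + 3 * (\<beta>\<^sup>2 * (g c)\<^sup>2) + 3 * \<beta>\<^sup>2 * (f c)\<^sup>2)"
    by (intro sum_mono pt)
  ultimately show ?thesis using S unfolding g_def by (simp add: algebra_simps)
qed

lemma edges_eq_Sigma: "edges N a = Sigma {..<N} (nbrs N a)"
  by (auto simp: edges_def nbrs_def)

lemma finite_edges: "finite (edges N a)"
  by (rule finite_subset[of _ "{..<N} \<times> {..<N}"]) (auto simp: edges_def)

lemma finite_nbrs: "finite (nbrs N a i)" and card_nbrs_le: "card (nbrs N a i) \<le> N"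
proof -
  have "nbrs N a i \<subseteq> {..<N}" by (auto simp: nbrs_def edges_def)
  then show "finite (nbrs N a i)" "card (nbrs N a i) \<le> N"
    using card_mono[of "{..<N}"] by (auto intro: finite_subset)
qed

section \<open>The algorithm, its estimation error and the two noise terms\<close>

locale SC_algorithm = prob_space M for M :: "'s measure" +
  fixes n N :: nat
    and a nu b :: "nat \<Rightarrow> nat \<Rightarrow> real"
    and alpha :: "nat \<Rightarrow> nat \<Rightarrow> nat \<Rightarrow> real"
    and beta :: "nat \<Rightarrow> nat \<Rightarrow> real"
    and m :: "nat \<Rightarrow> nat"
    and H :: "nat \<Rightarrow> nat \<Rightarrow> nat \<Rightarrow> nat \<Rightarrow> real"
    and theta :: "nat \<Rightarrow> real"
    and w :: "nat \<Rightarrow> nat \<Rightarrow> 's \<Rightarrow> nat \<Rightarrow> real"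
    and d :: "nat \<Rightarrow> nat \<Rightarrow> 's \<Rightarrow> real"
    and theta0 :: "nat \<Rightarrow> nat \<Rightarrow> real"
  assumes dim: "0 < n"
    and a_sym: "\<And>i j. a i j = a j i"
    and A1_bound: "\<exists>Hb>0. \<forall>i<N. \<forall>k\<ge>1. \<forall>x.
                     vnorm (m i) (matvec (m i) n (H i k) x) \<le> Hb * vnorm n x"
    and w_meas: "\<And>i k r. i < N \<Longrightarrow> 1 \<le> k \<Longrightarrow> r < m i \<Longrightarrow> (\<lambda>\<omega>. w i k \<omega> r) \<in> borel_measurable M"
    and w_int: "\<And>i k r. i < N \<Longrightarrow> 1 \<le> k \<Longrightarrow> r < m i \<Longrightarrow> integrable M (\<lambda>\<omega>. w i k \<omega> r)"
    and w_mds: "\<And>i k r. i < N \<Longrightarrow> 1 \<le> k \<Longrightarrow> r < m i \<Longrightarrow>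
                  AE \<omega> in M. real_cond_exp M (filtF M N m w d (k - 1)) (\<lambda>\<omega>. w i k \<omega> r) \<omega> = 0"
    and w_mom: "\<exists>\<rho>>2. AE \<omega> in M.
                  (SUP ik\<in>{(i,k). i < N \<and> 1 \<le> k}.
                     nn_cond_exp M (filtFw M N m w (snd ik - 1))
                       (\<lambda>\<omega>'. ennreal (vnorm (m (fst ik)) (w (fst ik) (snd ik) \<omega>') powr \<rho>)) \<omega>) < \<infinity>"
    and d_lap: "\<And>i k. i < N \<Longrightarrow> 1 \<le> k \<Longrightarrow>
                  distributed M lborel (d i k) (\<lambda>x. ennreal (exp (- \<bar>x\<bar>) / 2))"
    and d_indep: "indep_sets
                    (\<lambda>z. case z of
                        None \<Rightarrow> gen_sets M {(\<lambda>\<omega>. w i t \<omega> r) | i t r. i < N \<and> 1 \<le> t \<and> r < m i}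
                      | Some (i, k) \<Rightarrow> gen_sets M {d i k})
                    ({None} \<union> {Some (i, k) | i k. i < N \<and> 1 \<le> k})"
    and nu_sym: "\<And>i j. (i, j) \<in> edges N a \<Longrightarrow> nu i j = nu j i"
    and nu_nonneg: "\<And>i j. (i, j) \<in> edges N a \<Longrightarrow> 0 \<le> nu i j"
    and b_sym: "\<And>i j. (i, j) \<in> edges N a \<Longrightarrow> b i j = b j i"
    and b_pos: "\<And>i j. (i, j) \<in> edges N a \<Longrightarrow> 0 < b i j"
    and alpha_sym: "\<And>i j k. (i, j) \<in> edges N a \<Longrightarrow> 1 \<le> k \<Longrightarrow> alpha i j k = alpha j i k"
    and alpha_pos: "\<And>i j k. (i, j) \<in> edges N a \<Longrightarrow> 1 \<le> k \<Longrightarrow> 0 < alpha i j k"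
    and beta_pos: "\<And>i k. i < N \<Longrightarrow> 1 \<le> k \<Longrightarrow> 0 < beta i k"
    and alpha_sq: "\<And>i j. (i, j) \<in> edges N a \<Longrightarrow> summable (\<lambda>k. (alpha i j (Suc k))\<^sup>2)"
    and beta_sq: "\<And>i. i < N \<Longrightarrow> summable (\<lambda>k. (beta i (Suc k))\<^sup>2)"
begin

abbreviation "E \<equiv> edges N a"
abbreviation "F \<equiv> filtF M N m w d"
abbreviation "Fw \<equiv> filtFw M N m w"
abbreviation "est \<equiv> est_SC n N a nu b alpha beta m H theta w d theta0"

definition err :: "nat \<Rightarrow> 's \<Rightarrow> nat \<Rightarrow> nat \<Rightarrow> real" where
  "err k \<omega> i c = est k \<omega> i c - theta c"

definition lyap :: "nat \<Rightarrow> 's \<Rightarrow> real" where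
  "lyap k \<omega> = (\<Sum>i<N. \<Sum>c<n. (err k \<omega> i c)\<^sup>2)"

text \<open>Index \<open>k\<close> refers to the step from \<open>k\<close> to \<open>k + 1\<close>: \<open>obs k \<omega> i\<close> is \<open>x\<close> of sensor \<open>i\<close> at time \<open>k + 1\<close>,
  and \<open>consensus k \<omega> i\<close> is the coefficient of the basis vector selected at time \<open>k + 1\<close>.\<close>

definition obs :: "nat \<Rightarrow> 's \<Rightarrow> nat \<Rightarrow> real" where
  "obs k \<omega> i = est k \<omega> i (coord n (Suc k))"

definition consensus :: "nat \<Rightarrow> 's \<Rightarrow> nat \<Rightarrow> real" where
  "consensus k \<omega> i = (\<Sum>j\<in>nbrs N a i. alpha i j (Suc k) * a i j *
     (shat nu b j i (Suc k) (obs k \<omega> j) (d j (Suc k) \<omega>) - Gfun nu b i j (Suc k) (obs k \<omega> i)))"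

text \<open>In contrast to \<open>consensus\<close>, \<open>Gfun\<close> is evaluated here at the
  state of the sender \<open>j\<close>, which is what makes every summand centred given the
  past.\<close>

definition dither_noise :: "nat \<Rightarrow> 's \<Rightarrow> real" where
  "dither_noise k \<omega> = (\<Sum>(i,j)\<in>E. alpha i j (Suc k) * a i j *
     (err k \<omega> i (coord n (Suc k)) *
      (shat nu b j i (Suc k) (obs k \<omega> j) (d j (Suc k) \<omega>) - Gfun nu b j i (Suc k) (obs k \<omega> j))))"

definition obs_noise :: "nat \<Rightarrow> 's \<Rightarrow> real" where
  "obs_noise k \<omega> = (\<Sum>i<N. beta i (Suc k) * (\<Sum>c<n. err k \<omega> i c * (\<Sum>r<m i. H i (Suc k) r c * w i (Suc k) \<omega> r)))"

lemma coord_less: "coord n k < n" using dim by (simp add: coord_def)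

lemma lyap_nonneg: "0 \<le> lyap k \<omega>" unfolding lyap_def by (intro sum_nonneg) auto

lemma err_sq_le_lyap: "i < N \<Longrightarrow> c < n \<Longrightarrow> (err k \<omega> i c)\<^sup>2 \<le> lyap k \<omega>"
proof -
  assume "i < N" "c < n"
  then have "(err k \<omega> i c)\<^sup>2 \<le> (\<Sum>c<n. (err k \<omega> i c)\<^sup>2)" by (intro member_le_sum) auto
  also have "\<dots> \<le> lyap k \<omega>" unfolding lyap_def
    using \<open>i < N\<close> by (intro member_le_sum[where f="\<lambda>i. \<Sum>c<n. (err k \<omega> i c)\<^sup>2"]) (auto intro: sum_nonneg)
  finally show ?thesis .
qed

lemma E_sym: "(i, j) \<in> E \<Longrightarrow> (j, i) \<in> E" using a_sym by (auto simp: edges_def)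

lemma E_less: "(i, j) \<in> E \<Longrightarrow> i < N" "(i, j) \<in> E \<Longrightarrow> j < N" by (auto simp: edges_def)

lemma Gfun_sym: "(i, j) \<in> E \<Longrightarrow> Gfun nu b i j k x = Gfun nu b j i k x"
  using nu_sym[of i j] b_sym[of i j] by (simp add: Gfun_def Cthr_def)

text \<open>Applied to a basis vector, the operator bound controls the norm of a column, and hence
  each of its entries.\<close>

lemma H_entry_bound: "\<exists>h. \<forall>i<N. \<forall>k\<ge>1. \<forall>r<m i. \<forall>c<n. \<bar>H i k r c\<bar> \<le> h"
proof -
  obtain h where h: "\<forall>i<N. \<forall>k\<ge>1. \<forall>x. vnorm (m i) (matvec (m i) n (H i k) x) \<le> h * vnorm n x"
    using A1_bound by blast
  have "\<bar>H i k r c\<bar> \<le> h" if "i < N" "1 \<le> k" "r < m i" "c < n" for i k r c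
  proof -
    define x :: "nat \<Rightarrow> real" where "x = (\<lambda>c'. if c' = c then 1 else 0)"
    have x: "vnorm n x = 1" using that by (simp add: vnorm_def x_def if_distrib[where f="\<lambda>x. x\<^sup>2"] cong: if_cong)
    have Hx: "matvec (m i) n (H i k) x r = H i k r c" using that
      by (simp add: matvec_def x_def if_distrib[where f="\<lambda>x. _ * x"] cong: if_cong)
    have "(matvec (m i) n (H i k) x r)\<^sup>2 \<le> (\<Sum>r<m i. (matvec (m i) n (H i k) x r)\<^sup>2)"
      using that by (intro member_le_sum) auto
    then have "\<bar>H i k r c\<bar> \<le> vnorm (m i) (matvec (m i) n (H i k) x)"
      unfolding vnorm_def Hx by (intro real_le_rsqrt) auto
    then show ?thesis using h that x by (metis mult.right_neutral order_trans)
  qed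
  then show ?thesis by blast
qed

text \<open>The unknown parameter cancels from the innovation, which becomes the observation noise
  minus \<open>H\<close> applied to the error.\<close>

lemma err_Suc:
  "err (Suc k) \<omega> i c = err k \<omega> i c + (if c = coord n (Suc k) then consensus k \<omega> i else 0)
     + beta i (Suc k) * (\<Sum>r<m i. H i (Suc k) r c * (w i (Suc k) \<omega> r - (\<Sum>c'<n. H i (Suc k) r c' * err k \<omega> i c')))"
proof -
  have eq: "(\<Sum>c<n. H i (Suc k) r c * theta c) + w i (Suc k) \<omega> r - (\<Sum>c'<n. H i (Suc k) r c' * est k \<omega> i c')
      = w i (Suc k) \<omega> r - (\<Sum>c'<n. H i (Suc k) r c' * err k \<omega> i c')" for r
    by (simp add: err_def right_diff_distrib sum_subtractf)
  have "est (Suc k) \<omega> i c = est k \<omega> i c + (if c = coord n (Suc k) then consensus k \<omega> i else 0)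
     + beta i (Suc k) * (\<Sum>r<m i. H i (Suc k) r c * (w i (Suc k) \<omega> r - (\<Sum>c'<n. H i (Suc k) r c' * err k \<omega> i c')))"
    by (simp add: Let_def eq consensus_def obs_def)
  then show ?thesis by (simp add: err_def[of "Suc k" \<omega> i c] err_def[of k \<omega> i c] del: est_SC.simps)
qed

text \<open>Symmetrising over the edges leaves the monotonicity defect of \<open>Gfun\<close>, which has the right sign.\<close>

lemma consensus_le_dither_noise:
  "(\<Sum>i<N. err k \<omega> i (coord n (Suc k)) * consensus k \<omega> i) \<le> dither_noise k \<omega>"
proof -
  let ?l = "coord n (Suc k)" and ?t = "Suc k"
  define x where "x = obs k \<omega>"
  define W where "W = (\<lambda>i j. alpha i j ?t * a i j)"
  define e where "e = (\<lambda>i. err k \<omega> i ?l)"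
  define s where "s = (\<lambda>i j. shat nu b j i ?t (x j) (d j ?t \<omega>))"
  define G where "G = (\<lambda>i j. Gfun nu b i j ?t)"
  have G_sym: "G i j = G j i" if "(i, j) \<in> E" for i j using Gfun_sym[OF that] by (auto simp: G_def)
  have swap: "(\<Sum>(i,j)\<in>E. f i j) = (\<Sum>(i,j)\<in>E. f j i)" for f :: "nat \<Rightarrow> nat \<Rightarrow> real"
    by (rule sum.reindex_bij_witness[where i=prod.swap and j=prod.swap]) (auto intro: E_sym)
  \<comment> \<open>\<open>T\<close> is the price of moving the argument of \<open>Gfun\<close> from
    the state of the receiver to that of the sender.\<close>
  define T where "T = (\<Sum>(i,j)\<in>E. W i j * (e i * (G i j (x j) - G i j (x i))))"
  \<comment> \<open>Reversing every edge leaves weights and \<open>Gfun\<close> unchanged and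
    exchanges the roles of \<open>i\<close> and \<open>j\<close>; averaging the two forms of
    \<open>T\<close> symmetrises it.\<close>
  have T2: "T = (\<Sum>(i,j)\<in>E. W i j * (e j * (G i j (x i) - G i j (x j))))"
  proof -
    have "W j i * (e j * (G j i (x i) - G j i (x j))) = W i j * (e j * (G i j (x i) - G i j (x j)))"
      if "(i, j) \<in> E" for i j
      using G_sym[OF that] alpha_sym[OF that, of ?t] a_sym[of i j] by (simp add: W_def)
    then show ?thesis unfolding T_def by (subst swap) (auto intro!: sum.cong)
  qed
  have "2 * T = (\<Sum>(i,j)\<in>E. W i j * (e i * (G i j (x j) - G i j (x i)))) + (\<Sum>(i,j)\<in>E. W i j * (e j * (G i j (x i) - G i j (x j))))"
    using T2 by (simp add: T_def)
  also have "\<dots> = (\<Sum>(i,j)\<in>E. W i j * ((x i - x j) * (G i j (x j) - G i j (x i))))"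
    \<comment> \<open>All errors refer to the same parameter, so \<open>e i - e j\<close> equals
      \<open>x i - x j\<close>.\<close>
    by (subst sum.distrib[symmetric]) (auto intro!: sum.cong simp: e_def x_def err_def obs_def algebra_simps)
  also have "\<dots> \<le> 0"
  proof (intro sum_nonpos, clarify)
    fix i j assume E: "(i, j) \<in> E"
    have "0 \<le> W i j" using alpha_pos[OF E, of ?t] E by (auto simp: W_def edges_def)
    moreover have "(x i - x j) * (G i j (x j) - G i j (x i)) \<le> 0"
      using Gfun_mono[of b i j "x i" "x j" nu ?t] Gfun_mono[of b i j "x j" "x i" nu ?t] b_pos[OF E]
      unfolding G_def by (cases "x i \<le> x j") (auto intro: mult_nonpos_nonneg mult_nonneg_nonpos)
    ultimately show "W i j * ((x i - x j) * (G i j (x j) - G i j (x i))) \<le> 0"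
      by (rule mult_nonneg_nonpos)
  qed
  finally have T: "T \<le> 0" by simp
  have "(\<Sum>i<N. e i * consensus k \<omega> i) = (\<Sum>i<N. \<Sum>j\<in>nbrs N a i. W i j * (e i * (s i j - G i j (x i))))"
    by (simp add: consensus_def W_def s_def G_def x_def sum_distrib_left mult_ac)
  also have "\<dots> = (\<Sum>(i,j)\<in>E. W i j * (e i * (s i j - G i j (x i))))"
    unfolding edges_eq_Sigma by (intro sum.Sigma) (auto simp: finite_nbrs)
  also have "\<dots> = (\<Sum>(i,j)\<in>E. W i j * (e i * (s i j - G j i (x j)))) + T"
  proof -
    have "W i j * (e i * (s i j - G i j (x i)))
        = W i j * (e i * (s i j - G j i (x j))) + W i j * (e i * (G i j (x j) - G i j (x i)))" if "(i, j) \<in> E" for i j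
      unfolding G_sym[OF that] by (simp add: algebra_simps)
    then show ?thesis unfolding T_def by (subst sum.distrib[symmetric]) (auto intro!: sum.cong)
  qed
  finally show ?thesis using T by (simp add: dither_noise_def e_def W_def s_def G_def x_def)
qed

text \<open>Cauchy-Schwarz over the neighbours: each centred message is at most 2 in absolute value
  and there are at most \<open>N\<close> neighbours, whence the factor
  \<open>4 * real N\<close>.\<close>

lemma consensus_sq_le:
  "(\<Sum>i<N. (consensus k \<omega> i)\<^sup>2) \<le> 4 * real N * (\<Sum>(i,j)\<in>E. (alpha i j (Suc k) * a i j)\<^sup>2)"
proof -
  have "(consensus k \<omega> i)\<^sup>2 \<le> 4 * real N * (\<Sum>j\<in>nbrs N a i. (alpha i j (Suc k) * a i j)\<^sup>2)" for i
  proof -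
    let ?s = "\<lambda>j. shat nu b j i (Suc k) (obs k \<omega> j) (d j (Suc k) \<omega>) - Gfun nu b i j (Suc k) (obs k \<omega> i)"
    have "(consensus k \<omega> i)\<^sup>2 \<le> (\<Sum>j\<in>nbrs N a i. (alpha i j (Suc k) * a i j)\<^sup>2) * (\<Sum>j\<in>nbrs N a i. (?s j)\<^sup>2)"
      unfolding consensus_def by (rule Cauchy_Schwarz_ineq_sum)
    also have "\<dots> \<le> (\<Sum>j\<in>nbrs N a i. (alpha i j (Suc k) * a i j)\<^sup>2) * (4 * real N)"
    proof (intro mult_left_mono sum_nonneg)
      have "(?s j)\<^sup>2 \<le> 2\<^sup>2" for j
        using abs_shat_diff_Gfun_le by (intro abs_le_square_iff[THEN iffD1]) simp
      then have "(\<Sum>j\<in>nbrs N a i. (?s j)\<^sup>2) \<le> (\<Sum>j\<in>nbrs N a i. 4)" by (intro sum_mono) simp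
      also have "\<dots> \<le> 4 * real N" using card_nbrs_le[of N a i] by simp
      finally show "(\<Sum>j\<in>nbrs N a i. (?s j)\<^sup>2) \<le> 4 * real N" .
    qed auto
    finally show ?thesis by (simp add: mult_ac)
  qed
  then have "(\<Sum>i<N. (consensus k \<omega> i)\<^sup>2) \<le> (\<Sum>i<N. 4 * real N * (\<Sum>j\<in>nbrs N a i. (alpha i j (Suc k) * a i j)\<^sup>2))"
    by (intro sum_mono) auto
  also have "\<dots> = 4 * real N * (\<Sum>i<N. \<Sum>j\<in>nbrs N a i. (alpha i j (Suc k) * a i j)\<^sup>2)"
    by (simp add: sum_distrib_left)
  also have "(\<Sum>i<N. \<Sum>j\<in>nbrs N a i. (alpha i j (Suc k) * a i j)\<^sup>2) = (\<Sum>(i,j)\<in>E. (alpha i j (Suc k) * a i j)\<^sup>2)"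
    unfolding edges_eq_Sigma by (intro sum.Sigma) (auto simp: finite_nbrs)
  finally show ?thesis .
qed

lemma lyap_Suc_le:
  "\<exists>P\<ge>0. \<forall>k \<omega>. lyap (Suc k) \<omega> \<le> (1 + 3 * P\<^sup>2 * (\<Sum>i<N. (beta i (Suc k))\<^sup>2)) * lyap k \<omega>
      + 2 * dither_noise k \<omega> + 2 * obs_noise k \<omega> + 12 * real N * (\<Sum>(i,j)\<in>E. (alpha i j (Suc k) * a i j)\<^sup>2)
      + 3 * P * (\<Sum>i<N. (beta i (Suc k))\<^sup>2 * (\<Sum>r<m i. (w i (Suc k) \<omega> r)\<^sup>2))"
proof -
  obtain h where h: "\<And>i k r c. i < N \<Longrightarrow> 1 \<le> k \<Longrightarrow> r < m i \<Longrightarrow> c < n \<Longrightarrow> \<bar>H i k r c\<bar> \<le> h"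
    using H_entry_bound by blast
  \<comment> \<open>Summing the dimensions \<open>m i\<close> gives a single constant for all
    sensors.\<close>
  define P where "P = real n * real (\<Sum>i<N. m i) * h\<^sup>2"
  have P: "real n * real (m i) * h\<^sup>2 \<le> P" if "i < N" for i
  proof -
    have "m i \<le> (\<Sum>i<N. m i)" using that by (intro member_le_sum) auto
    then have "real (m i) \<le> real (\<Sum>i<N. m i)" by (rule of_nat_mono)
    then show ?thesis unfolding P_def by (intro mult_right_mono mult_left_mono) auto
  qed
  have P0: "0 \<le> P" unfolding P_def by (intro mult_nonneg_nonneg of_nat_0_le_iff zero_le_power2)
  have "lyap (Suc k) \<omega> \<le> (1 + 3 * P\<^sup>2 * (\<Sum>i<N. (beta i (Suc k))\<^sup>2)) * lyap k \<omega>
      + 2 * dither_noise k \<omega> + 2 * obs_noise k \<omega> + 12 * real N * (\<Sum>(i,j)\<in>E. (alpha i j (Suc k) * a i j)\<^sup>2)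
      + 3 * P * (\<Sum>i<N. (beta i (Suc k))\<^sup>2 * (\<Sum>r<m i. (w i (Suc k) \<omega> r)\<^sup>2))" for k \<omega>
  proof -
    let ?l = "coord n (Suc k)" and ?t = "Suc k"
    let ?e2 = "\<lambda>i. \<Sum>c<n. (err k \<omega> i c)\<^sup>2"
    let ?on = "\<lambda>i. beta i ?t * (\<Sum>c<n. err k \<omega> i c * (\<Sum>r<m i. H i ?t r c * w i ?t \<omega> r))"
    have 1: "(\<Sum>c<n. (err (Suc k) \<omega> i c)\<^sup>2) \<le> (1 + 3 * P\<^sup>2 * (\<Sum>i<N. (beta i ?t)\<^sup>2)) * ?e2 i
        + 2 * (err k \<omega> i ?l * consensus k \<omega> i) + 2 * ?on i + 3 * (consensus k \<omega> i)\<^sup>2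
        + 3 * P * ((beta i ?t)\<^sup>2 * (\<Sum>r<m i. (w i ?t \<omega> r)\<^sup>2))" if i: "i < N" for i
    proof -
      have "(\<Sum>c<n. (err (Suc k) \<omega> i c)\<^sup>2) \<le> (1 + 3 * (beta i ?t)\<^sup>2 * P\<^sup>2) * ?e2 i
        + 2 * (err k \<omega> i ?l * consensus k \<omega> i) + 2 * ?on i + 3 * (consensus k \<omega> i)\<^sup>2
        + 3 * P * ((beta i ?t)\<^sup>2 * (\<Sum>r<m i. (w i ?t \<omega> r)\<^sup>2))"
        unfolding err_Suc using coord_less beta_pos[OF i, of ?t] h[OF i, of ?t] P[OF i]
        by (intro sensor_update_sq_le) auto
      \<comment> \<open>The step size of one sensor is replaced by the sum over all sensors, so that
        the same growth factor multiplies every error and hence \<open>lyap\<close>.\<close>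
      moreover have "(1 + 3 * (beta i ?t)\<^sup>2 * P\<^sup>2) * ?e2 i \<le> (1 + 3 * P\<^sup>2 * (\<Sum>i<N. (beta i ?t)\<^sup>2)) * ?e2 i"
      proof (intro mult_right_mono sum_nonneg add_left_mono)
        have "(beta i ?t)\<^sup>2 \<le> (\<Sum>i<N. (beta i ?t)\<^sup>2)" using i by (intro member_le_sum) auto
        then show "3 * (beta i ?t)\<^sup>2 * P\<^sup>2 \<le> 3 * P\<^sup>2 * (\<Sum>i<N. (beta i ?t)\<^sup>2)"
          by (simp add: mult_ac mult_left_mono)
      qed auto
      ultimately show ?thesis by linarith
    qed
    have "lyap (Suc k) \<omega> \<le> (\<Sum>i<N. (1 + 3 * P\<^sup>2 * (\<Sum>i<N. (beta i ?t)\<^sup>2)) * ?e2 i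
        + 2 * (err k \<omega> i ?l * consensus k \<omega> i) + 2 * ?on i + 3 * (consensus k \<omega> i)\<^sup>2
        + 3 * P * ((beta i ?t)\<^sup>2 * (\<Sum>r<m i. (w i ?t \<omega> r)\<^sup>2)))"
      unfolding lyap_def by (intro sum_mono 1) auto
    also have "\<dots> = (1 + 3 * P\<^sup>2 * (\<Sum>i<N. (beta i ?t)\<^sup>2)) * lyap k \<omega>
        + 2 * (\<Sum>i<N. err k \<omega> i ?l * consensus k \<omega> i) + 2 * obs_noise k \<omega> + 3 * (\<Sum>i<N. (consensus k \<omega> i)\<^sup>2)
        + 3 * P * (\<Sum>i<N. (beta i ?t)\<^sup>2 * (\<Sum>r<m i. (w i ?t \<omega> r)\<^sup>2))"
      by (simp only: sum.distrib sum_distrib_left[symmetric] lyap_def obs_noise_def)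
    finally show ?thesis
      using consensus_le_dither_noise[of k \<omega>] consensus_sq_le[of k \<omega>] by linarith
  qed
  with P0 show ?thesis by blast
qed

subsection \<open>Adaptedness and centred noise\<close>

lemma d_meas: "i < N \<Longrightarrow> 1 \<le> k \<Longrightarrow> d i k \<in> borel_measurable M"
  using distributed_measurable[OF d_lap] by simp

lemma distr_d: "i < N \<Longrightarrow> 1 \<le> k \<Longrightarrow> distr M borel (d i k) = laplace"
  using distributed_distr_eq_density[OF d_lap, of i k] distr_cong[of M M borel lborel "d i k" "d i k"]
  by (simp add: laplace_def)

lemma subalg_F: "subalgebra M (F k)"
  unfolding filtF_def by (rule subalgebra_gen_alg) (blast intro: w_meas d_meas)

lemma subalg_Fw: "subalgebra M (Fw k)"
  unfolding filtFw_def by (rule subalgebra_gen_alg) (blast intro: w_meas)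

lemma subalg_F_mono: "j \<le> k \<Longrightarrow> subalgebra (F k) (F j)"
  unfolding filtF_def by (rule subalgebra_gen_alg_mono) (use le_trans in blast)

lemma subalg_F_Fw: "subalgebra (F k) (Fw k)"
  unfolding filtF_def filtFw_def by (rule subalgebra_gen_alg_mono) blast

lemma w_F: "i < N \<Longrightarrow> 1 \<le> t \<Longrightarrow> t \<le> k \<Longrightarrow> r < m i \<Longrightarrow> (\<lambda>\<omega>. w i t \<omega> r) \<in> borel_measurable (F k)"
  unfolding filtF_def by (rule gen_alg_measurable) blast

lemma d_F: "i < N \<Longrightarrow> 1 \<le> t \<Longrightarrow> t \<le> k \<Longrightarrow> d i t \<in> borel_measurable (F k)"
  unfolding filtF_def by (rule gen_alg_measurable) blast

lemma shat_comp_measurable: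
  assumes [measurable]: "f \<in> borel_measurable A" "g \<in> borel_measurable A"
  shows "(\<lambda>\<omega>. shat nu b j i k (f \<omega>) (g \<omega>)) \<in> borel_measurable A"
  using measurable_compose[OF measurable_Pair[OF assms] shat_measurable[of nu b j i k]] by simp

lemma est_F: "i < N \<Longrightarrow> (\<lambda>\<omega>. est k \<omega> i c) \<in> borel_measurable (F k)"
proof (induction k arbitrary: i c)
  case 0 then show ?case by simp
next
  case (Suc k)
  have prev: "(\<lambda>\<omega>. est k \<omega> i c) \<in> borel_measurable (F (Suc k))" if "i < N" for i c
    using measurable_from_subalg[OF subalg_F_mono Suc.IH[OF that]] by simp
  have nb: "j < N" if "j \<in> nbrs N a i" for j using that by (auto simp: nbrs_def edges_def)
  show ?case unfolding est_SC.simps Let_def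
    using Suc.prems
    by (intro borel_measurable_add borel_measurable_times borel_measurable_sum borel_measurable_diff borel_measurable_const
           shat_comp_measurable measurable_compose[OF _ Gfun_measurable] prev w_F d_F measurable_If) (auto dest: nb)
qed

lemma err_F: "i < N \<Longrightarrow> (\<lambda>\<omega>. err k \<omega> i c) \<in> borel_measurable (F k)"
  unfolding err_def by (intro borel_measurable_diff est_F) auto

lemma lyap_F: "lyap k \<in> borel_measurable (F k)"
  unfolding lyap_def[abs_def] by (intro borel_measurable_sum borel_measurable_power err_F) auto

text \<open>The independent family is grouped into two blocks: the observation noise together with
  the dithers up to time \<open>k\<close>, and the single dither of sensor \<open>j\<close> at time
  \<open>k + 1\<close>. Independence of the families passes to the sigma-algebras generated by the
  blocks, and the first of these contains \<open>F k\<close>.\<close>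

lemma indep_F_d:
  assumes j: "j < N" and A: "A \<in> sets (F k)" and B: "B \<in> sets borel"
  shows "prob (A \<inter> (d j (Suc k) -` B \<inter> space M)) = prob A * prob (d j (Suc k) -` B \<inter> space M)"
proof -
  let ?G = "\<lambda>z. case z of None \<Rightarrow> gen_sets M {(\<lambda>\<omega>. w i t \<omega> r) | i t r. i < N \<and> 1 \<le> t \<and> r < m i}
                      | Some (i, k) \<Rightarrow> gen_sets M {d i k}"
  \<comment> \<open>The index \<open>None\<close> stands for the observation noise at all times, so
    the first block may be larger than \<open>F k\<close>.\<close>
  define I where "I = (\<lambda>z. if z then {None} \<union> {Some (i, t) | i t. i < N \<and> 1 \<le> t \<and> t \<le> k} else {Some (j, Suc k)})"
  have "indep_sets (\<lambda>z. sigma_sets (space M) (\<Union>y\<in>I z. ?G y)) UNIV"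
  proof (rule indep_sets_collect_sigma)
    show "indep_sets ?G (\<Union>z\<in>UNIV. I z)"
      by (rule indep_sets_mono_index[OF _ d_indep]) (use j in \<open>auto simp: I_def split: if_splits\<close>)
    show "Int_stable (?G y)" for y
      by (cases y) (auto simp flip: sets_gen_alg intro!: sets.Int_stable split: prod.splits)
    show "disjoint_family_on I UNIV" by (auto simp: disjoint_family_on_def I_def split: if_splits)
  qed
  then have ind: "prob (\<Inter>z\<in>UNIV. (if z then A else B')) = (\<Prod>z\<in>UNIV. prob (if z then A else B'))"
    if "A \<in> sigma_sets (space M) (\<Union>y\<in>I True. ?G y)" "B' \<in> sigma_sets (space M) (\<Union>y\<in>I False. ?G y)" for A B'
    using that by (intro indep_setsD[where I=UNIV]) auto
  have "A \<in> sigma_sets (space M) (\<Union>y\<in>I True. ?G y)"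
  proof -
    have "gen_sets M ({(\<lambda>\<omega>. w i t \<omega> r) | i t r. i < N \<and> 1 \<le> t \<and> t \<le> k \<and> r < m i} \<union>
      {d i t | i t. i < N \<and> 1 \<le> t \<and> t \<le> k}) \<subseteq> sigma_sets (space M) (\<Union>y\<in>I True. ?G y)"
      (is "gen_sets M (?W \<union> ?D) \<subseteq> _")
    proof -
      have cover: "{f -` B \<inter> space M |B. B \<in> sets borel} \<subseteq> (\<Union>y\<in>I True. ?G y)" if "f \<in> ?W \<union> ?D" for f
      proof -
        obtain y fs where y: "y \<in> I True" "?G y = gen_sets M fs" "f \<in> fs"
        proof (cases "f \<in> ?W")
          case True
          then have "f \<in> {(\<lambda>\<omega>. w i t \<omega> r) | i t r. i < N \<and> 1 \<le> t \<and> r < m i}" by blast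
          then show thesis by (intro that[of None]) (auto simp: I_def)
        next
          case False
          then obtain i t where "f = d i t" "i < N" "1 \<le> t" "t \<le> k" using \<open>f \<in> ?W \<union> ?D\<close> by blast
          then show thesis by (intro that[of "Some (i, t)"]) (auto simp: I_def)
        qed
        have "{f -` B \<inter> space M |B. B \<in> sets borel} \<subseteq> gen_sets M fs"
          using y(3) by (auto simp: gen_sets_def)
        then show ?thesis using y by blast
      qed
      show ?thesis unfolding gen_sets_def[of M "?W \<union> ?D"] by (rule sigma_sets_mono'[OF UN_least], rule cover)
    qed
    then show ?thesis using A by (auto simp: filtF_def sets_gen_alg)
  qed
  moreover have "d j (Suc k) -` B \<inter> space M \<in> sigma_sets (space M) (\<Union>y\<in>I False. ?G y)"
    using B by (auto simp: I_def gen_sets_def intro!: sigma_sets.Basic)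
  ultimately show ?thesis using ind by (simp add: UNIV_bool Int_commute mult.commute)
qed

lemma Cthr_nonneg: "(i, j) \<in> E \<Longrightarrow> 1 \<le> k \<Longrightarrow> 0 \<le> Cthr nu b i j k"
  using nu_nonneg[of i j] b_pos[of i j] by (simp add: Cthr_def)

text \<open>Both \<open>f\<close> and \<open>g\<close> are determined by the past, hence independent
  of the next dither. With their values fixed, averaging over the Laplace dither gives zero;
  boundedness of \<open>f\<close> provides integrability.\<close>

lemma integral_dither:
  assumes E: "(j, i) \<in> E"
    and f: "f \<in> borel_measurable (F k)" and g: "g \<in> borel_measurable (F k)"
    and bd: "\<And>\<omega>. \<bar>f \<omega>\<bar> \<le> R"
  shows "integrable M (\<lambda>\<omega>. f \<omega> * (shat nu b j i (Suc k) (g \<omega>) (d j (Suc k) \<omega>) - Gfun nu b j i (Suc k) (g \<omega>)))"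
    and "(\<integral>\<omega>. f \<omega> * (shat nu b j i (Suc k) (g \<omega>) (d j (Suc k) \<omega>) - Gfun nu b j i (Suc k) (g \<omega>)) \<partial>M) = 0"
proof -
  have j: "j < N" using E_less[OF E] by auto
  note [measurable] = measurable_from_subalg[OF subalg_F f] measurable_from_subalg[OF subalg_F g]
  have [measurable]: "d j (Suc k) \<in> borel_measurable M" using d_meas j by simp
  interpret L: prob_space laplace by (rule prob_space_laplace)
  define \<phi> where "\<phi> = (\<lambda>z. fst (fst z) * (shat nu b j i (Suc k) (snd (fst z)) (snd z) - Gfun nu b j i (Suc k) (snd (fst z))))"
  have [measurable]: "\<phi> \<in> borel_measurable ((borel \<Otimes>\<^sub>M borel) \<Otimes>\<^sub>M borel)"
    unfolding \<phi>_def
    by (intro borel_measurable_times borel_measurable_diff shat_comp_measurable measurable_compose[OF _ Gfun_measurable]) measurable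
  have eq: "(\<lambda>\<omega>. f \<omega> * (shat nu b j i (Suc k) (g \<omega>) (d j (Suc k) \<omega>) - Gfun nu b j i (Suc k) (g \<omega>)))
      = (\<lambda>\<omega>. \<phi> ((f \<omega>, g \<omega>), d j (Suc k) \<omega>))" by (simp add: \<phi>_def)
  have R: "0 \<le> R" using bd[of undefined] by linarith
  show int: "integrable M (\<lambda>\<omega>. f \<omega> * (shat nu b j i (Suc k) (g \<omega>) (d j (Suc k) \<omega>) - Gfun nu b j i (Suc k) (g \<omega>)))"
  proof (rule integrable_const_bound[of _ "R * 2"])
    show "AE \<omega> in M. norm (f \<omega> * (shat nu b j i (Suc k) (g \<omega>) (d j (Suc k) \<omega>) - Gfun nu b j i (Suc k) (g \<omega>))) \<le> R * 2"
      unfolding real_norm_def abs_mult using bd abs_shat_diff_Gfun_le R by (intro AE_I2 mult_mono) auto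
    show "(\<lambda>\<omega>. f \<omega> * (shat nu b j i (Suc k) (g \<omega>) (d j (Suc k) \<omega>) - Gfun nu b j i (Suc k) (g \<omega>))) \<in> borel_measurable M"
      unfolding eq by measurable
  qed
  show "(\<integral>\<omega>. f \<omega> * (shat nu b j i (Suc k) (g \<omega>) (d j (Suc k) \<omega>) - Gfun nu b j i (Suc k) (g \<omega>)) \<partial>M) = 0"
    unfolding eq
  proof (rule expectation_indep_eq_0[where S="borel \<Otimes>\<^sub>M borel" and T=borel])
    fix A :: "(real \<times> real) set" and B assume AB: "A \<in> sets (borel \<Otimes>\<^sub>M borel)" "B \<in> sets (borel :: real measure)"
    have "(\<lambda>\<omega>. (f \<omega>, g \<omega>)) -` A \<inter> space M \<in> sets (F k)"
      using measurable_sets[OF measurable_Pair[OF f g] AB(1)] subalg_F[of k] by (simp add: subalgebra_def)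
    then show "prob (((\<lambda>\<omega>. (f \<omega>, g \<omega>)) -` A \<inter> space M) \<inter> (d j (Suc k) -` B \<inter> space M))
        = prob ((\<lambda>\<omega>. (f \<omega>, g \<omega>)) -` A \<inter> space M) * prob (d j (Suc k) -` B \<inter> space M)"
      by (rule indep_F_d[OF j _ AB(2)])
  next
    fix x
    show "(\<integral>y. \<phi> (x, y) \<partial>distr M borel (d j (Suc k))) = 0"
      using integral_laplace_shat[of b j i nu "Suc k" "snd x"] b_pos[OF E] Cthr_nonneg[OF E, of "Suc k"] j
        L.prob_space
      by (simp add: distr_d \<phi>_def)
  next
    show "integrable M (\<lambda>\<omega>. \<phi> ((f \<omega>, g \<omega>), d j (Suc k) \<omega>))" using int unfolding eq .
  qed measurable
qed

subsection \<open>Boundedness of the estimates\<close>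

definition cond_mom :: "real \<Rightarrow> nat \<Rightarrow> nat \<Rightarrow> 's \<Rightarrow> ennreal" where
  "cond_mom \<rho> i k = nn_cond_exp M (Fw (k - 1)) (\<lambda>\<omega>. ennreal (vnorm (m i) (w i k \<omega>) powr \<rho>))"

lemma cond_mom_Fw: "cond_mom \<rho> i k \<in> borel_measurable (Fw (k - 1))"
  unfolding cond_mom_def by (rule borel_measurable_nn_cond_exp)

text \<open>A square is at most 1 plus the power with exponent \<open>\<rho>\<close>. The truncating
  event belongs to \<open>Fw (k - 1)\<close>, so on it the power may be replaced by its conditional
  expectation, which is at most \<open>L\<close> there.\<close>

lemma truncated_second_moment_le:
  assumes i: "i < N" and k: "1 \<le> k" and \<rho>: "2 < \<rho>" and L: "0 \<le> L"
  shows "(\<integral>\<^sup>+\<omega>. indicator {\<omega>\<in>space M. cond_mom \<rho> i k \<omega> \<le> ennreal L} \<omega> * ennreal (\<Sum>r<m i. (w i k \<omega> r)\<^sup>2) \<partial>M)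
    \<le> ennreal (1 + L)"
proof -
  interpret Fw: finite_measure_subalgebra M "Fw (k - 1)"
    by unfold_locales (rule subalg_Fw)
  define S where "S = {\<omega>\<in>space M. cond_mom \<rho> i k \<omega> \<le> ennreal L}"
  have sp: "space (Fw (k - 1)) = space M" using subalg_Fw by (simp add: subalgebra_def)
  note [measurable] = cond_mom_Fw[of \<rho> i k]
  have "{\<omega>\<in>space (Fw (k - 1)). cond_mom \<rho> i k \<omega> \<le> ennreal L} \<in> sets (Fw (k - 1))" by measurable
  then have S[measurable]: "S \<in> sets (Fw (k - 1))" unfolding sp S_def .
  then have S_M[measurable]: "S \<in> sets M" using subalg_Fw by (auto simp: subalgebra_def)
  define g where "g = (\<lambda>\<omega>. vnorm (m i) (w i k \<omega>) powr \<rho>)"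
  have g_M[measurable]: "g \<in> borel_measurable M"
    unfolding g_def vnorm_def
    by (intro powr_real_measurable measurable_compose[OF _ borel_measurable_sqrt] borel_measurable_sum borel_measurable_power w_meas i k) auto
  have pt: "(\<Sum>r<m i. (w i k \<omega> r)\<^sup>2) \<le> 1 + g \<omega>" for \<omega>
  proof -
    define v where "v = vnorm (m i) (w i k \<omega>)"
    have v0: "0 \<le> v" by (simp add: v_def vnorm_def sum_nonneg)
    have eq: "(\<Sum>r<m i. (w i k \<omega> r)\<^sup>2) = v\<^sup>2" by (simp add: v_def vnorm_def sum_nonneg)
    have "v\<^sup>2 \<le> 1 + v powr \<rho>"
    proof (cases "v \<le> 1")
      case True
      then have "v\<^sup>2 \<le> 1" using v0 by (simp add: power_le_one)
      then show ?thesis using powr_ge_zero[of v \<rho>] by linarith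
    next
      case False
      then have "v powr 2 \<le> v powr \<rho>" using \<rho> by (intro powr_mono) auto
      moreover have "v powr 2 = v\<^sup>2" using False by (simp add: powr_numeral)
      ultimately show ?thesis by simp
    qed
    then show ?thesis by (simp add: eq g_def v_def)
  qed
  have "(\<integral>\<^sup>+\<omega>. indicator S \<omega> * ennreal (\<Sum>r<m i. (w i k \<omega> r)\<^sup>2) \<partial>M)
      \<le> (\<integral>\<^sup>+\<omega>. 1 + indicator S \<omega> * ennreal (g \<omega>) \<partial>M)"
  proof (rule nn_integral_mono)
    fix \<omega>
    have "ennreal (\<Sum>r<m i. (w i k \<omega> r)\<^sup>2) \<le> ennreal (1 + g \<omega>)" by (rule ennreal_leI[OF pt])
    also have "\<dots> = 1 + ennreal (g \<omega>)" by (simp add: g_def)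
    finally show "indicator S \<omega> * ennreal (\<Sum>r<m i. (w i k \<omega> r)\<^sup>2) \<le> 1 + indicator S \<omega> * ennreal (g \<omega>)"
      by (cases "\<omega> \<in> S") auto
  qed
  also have "\<dots> = 1 + (\<integral>\<^sup>+\<omega>. indicator S \<omega> * ennreal (g \<omega>) \<partial>M)"
    by (subst nn_integral_add) (auto simp: emeasure_space_1)
  also have "(\<integral>\<^sup>+\<omega>. indicator S \<omega> * ennreal (g \<omega>) \<partial>M) = (\<integral>\<^sup>+\<omega>. indicator S \<omega> * cond_mom \<rho> i k \<omega> \<partial>M)"
    unfolding cond_mom_def fun_cong[OF g_def, symmetric]
    by (rule Fw.nn_cond_exp_intg[OF borel_measurable_indicator[OF S] measurable_compose[OF g_M measurable_ennreal], symmetric])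
  also have "\<dots> \<le> (\<integral>\<^sup>+\<omega>. ennreal L \<partial>M)"
    by (intro nn_integral_mono) (auto simp: S_def indicator_def)
  also have "\<dots> = ennreal L" by (simp add: emeasure_space_1)
  finally have "(\<integral>\<^sup>+\<omega>. indicator S \<omega> * ennreal (\<Sum>r<m i. (w i k \<omega> r)\<^sup>2) \<partial>M) \<le> 1 + ennreal L"
    by (simp add: add_left_mono)
  then show ?thesis using L by (simp add: S_def)
qed

text \<open>The event \<open>B\<close> may depend on dithers and so need not lie in
  \<open>Fw (k - 1)\<close>. The integrand is nonnegative, so \<open>B\<close> can be enlarged to
  the truncating event of \<open>truncated_second_moment_le\<close>, which does lie there.\<close>

lemma integral_sq_on_le:
  assumes i: "i < N" and k: "1 \<le> k" and \<rho>: "2 < \<rho>" and L: "0 \<le> L" and B: "B \<in> sets M"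
    and mom: "\<And>\<omega>. \<omega> \<in> B \<Longrightarrow> cond_mom \<rho> i k \<omega> \<le> ennreal L"
  shows "integrable M (\<lambda>\<omega>. indicator B \<omega> * (\<Sum>r<m i. (w i k \<omega> r)\<^sup>2))"
    and "(\<integral>\<omega>. indicator B \<omega> * (\<Sum>r<m i. (w i k \<omega> r)\<^sup>2) \<partial>M) \<le> 1 + L"
proof -
  let ?f = "\<lambda>\<omega>. indicator B \<omega> * (\<Sum>r<m i. (w i k \<omega> r)\<^sup>2)"
  have f0: "0 \<le> ?f \<omega>" for \<omega> by (simp add: sum_nonneg)
  have f_M: "?f \<in> borel_measurable M"
    by (intro borel_measurable_times borel_measurable_indicator B borel_measurable_sum borel_measurable_power w_meas i k) auto
  have "(\<integral>\<^sup>+\<omega>. ennreal (?f \<omega>) \<partial>M)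
      \<le> (\<integral>\<^sup>+\<omega>. indicator {\<omega>\<in>space M. cond_mom \<rho> i k \<omega> \<le> ennreal L} \<omega> * ennreal (\<Sum>r<m i. (w i k \<omega> r)\<^sup>2) \<partial>M)"
    by (rule nn_integral_mono) (auto simp: indicator_def mom)
  also have "\<dots> \<le> ennreal (1 + L)" by (rule truncated_second_moment_le[OF i k \<rho> L])
  finally have le: "(\<integral>\<^sup>+\<omega>. ennreal (?f \<omega>) \<partial>M) \<le> ennreal (1 + L)" .
  show int: "integrable M ?f"
    by (rule integrableI_nonneg[OF f_M]) (use f0 le in \<open>auto intro: le_less_trans\<close>)
  have "ennreal (integral\<^sup>L M ?f) \<le> ennreal (1 + L)"
    using le nn_integral_eq_integral[OF int] f0 by simp
  then show "integral\<^sup>L M ?f \<le> 1 + L" using L by (subst (asm) ennreal_le_iff) auto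
qed

text \<open>The past factor \<open>f\<close> is pulled out of the conditional expectation given
  \<open>F k\<close>, which vanishes by the martingale difference property.\<close>

lemma integral_obs_noise_term:
  assumes i: "i < N" and r: "r < m i" and f: "f \<in> borel_measurable (F k)" and bd: "\<And>\<omega>. \<bar>f \<omega>\<bar> \<le> R"
  shows "integrable M (\<lambda>\<omega>. f \<omega> * w i (Suc k) \<omega> r)" and "(\<integral>\<omega>. f \<omega> * w i (Suc k) \<omega> r \<partial>M) = 0"
proof -
  interpret F: finite_measure_subalgebra M "F k" by unfold_locales (rule subalg_F)
  have w: "integrable M (\<lambda>\<omega>. w i (Suc k) \<omega> r)" "(\<lambda>\<omega>. w i (Suc k) \<omega> r) \<in> borel_measurable M"
    using w_int[OF i _ r, of "Suc k"] w_meas[OF i _ r, of "Suc k"] by auto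
  note f_M = measurable_from_subalg[OF subalg_F f]
  show int: "integrable M (\<lambda>\<omega>. f \<omega> * w i (Suc k) \<omega> r)"
  proof (rule Bochner_Integration.integrable_bound)
    show "integrable M (\<lambda>\<omega>. R * w i (Suc k) \<omega> r)" using w by simp
    show "AE \<omega> in M. norm (f \<omega> * w i (Suc k) \<omega> r) \<le> norm (R * w i (Suc k) \<omega> r)"
      unfolding norm_mult using order_trans[OF bd abs_ge_self] by (intro AE_I2 mult_right_mono) auto
  qed (intro borel_measurable_times f_M w)
  have "(\<integral>\<omega>. f \<omega> * w i (Suc k) \<omega> r \<partial>M) = (\<integral>\<omega>. f \<omega> * real_cond_exp M (F k) (\<lambda>\<omega>. w i (Suc k) \<omega> r) \<omega> \<partial>M)"
    by (rule F.real_cond_exp_intg(2)[OF int f w(2), symmetric])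
  also have "\<dots> = (\<integral>\<omega>. 0 \<partial>M)"
  proof (rule integral_cong_AE)
    show "(\<lambda>\<omega>. f \<omega> * real_cond_exp M (F k) (\<lambda>\<omega>. w i (Suc k) \<omega> r) \<omega>) \<in> borel_measurable M"
      by (intro borel_measurable_times f_M borel_measurable_cond_exp2)
    show "AE \<omega> in M. f \<omega> * real_cond_exp M (F k) (\<lambda>\<omega>. w i (Suc k) \<omega> r) \<omega> = 0"
      using w_mds[OF i _ r, of "Suc k"] by auto
  qed simp
  finally show "(\<integral>\<omega>. f \<omega> * w i (Suc k) \<omega> r \<partial>M) = 0" by simp
qed

section \<open>Integrating the one-step bound over an event of the past\<close>

context
  fixes B k R
  assumes B: "B \<in> sets (F k)" and bd: "\<And>\<omega>. \<omega> \<in> B \<Longrightarrow> lyap k \<omega> \<le> R"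
begin

lemma err_on_F: "i < N \<Longrightarrow> (\<lambda>\<omega>. indicator B \<omega> * err k \<omega> i c) \<in> borel_measurable (F k)"
  using B by (intro borel_measurable_times borel_measurable_indicator err_F)

lemma err_on_bound: "i < N \<Longrightarrow> c < n \<Longrightarrow> \<bar>indicator B \<omega> * err k \<omega> i c\<bar> \<le> 1 + \<bar>R\<bar>"
proof (cases "\<omega> \<in> B")
  case True
  assume "i < N" "c < n"
  \<comment> \<open>The absolute value is taken because \<open>R\<close> may be negative when
    \<open>B\<close> is empty; bounding by 1 plus the square avoids a square root.\<close>
  then have "(err k \<omega> i c)\<^sup>2 \<le> \<bar>R\<bar>" using err_sq_le_lyap[of i c k \<omega>] bd[OF True] by linarith
  moreover have "\<bar>err k \<omega> i c\<bar> \<le> 1 + (err k \<omega> i c)\<^sup>2"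
    using zero_le_power2[of "\<bar>err k \<omega> i c\<bar> - 1"] by (simp add: power2_eq_square algebra_simps abs_mult_self_eq)
  ultimately show ?thesis using True by simp
qed simp

lemma integral_dither_noise:
  "integrable M (\<lambda>\<omega>. indicator B \<omega> * dither_noise k \<omega>)" "(\<integral>\<omega>. indicator B \<omega> * dither_noise k \<omega> \<partial>M) = 0"
proof -
  let ?l = "coord n (Suc k)"
  let ?s = "\<lambda>\<omega> i j. shat nu b j i (Suc k) (obs k \<omega> j) (d j (Suc k) \<omega>) - Gfun nu b j i (Suc k) (obs k \<omega> j)"
  have eq: "(\<lambda>\<omega>. indicator B \<omega> * dither_noise k \<omega>) =
      (\<lambda>\<omega>. \<Sum>e\<in>E. alpha (fst e) (snd e) (Suc k) * a (fst e) (snd e) *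
        ((indicator B \<omega> * err k \<omega> (fst e) ?l) * ?s \<omega> (fst e) (snd e)))"
    by (simp add: dither_noise_def sum_distrib_left case_prod_beta mult_ac)
  have *: "integrable M (\<lambda>\<omega>. (indicator B \<omega> * err k \<omega> i ?l) * ?s \<omega> i j)"
    "(\<integral>\<omega>. (indicator B \<omega> * err k \<omega> i ?l) * ?s \<omega> i j \<partial>M) = 0" if "(i, j) \<in> E" for i j
  proof -
    have "(\<lambda>\<omega>. obs k \<omega> j) \<in> borel_measurable (F k)" using E_less[OF that] by (simp add: obs_def est_F)
    \<comment> \<open>The summand of the edge \<open>(i, j)\<close> contains the message sent by
      \<open>j\<close>, so the reversed edge is used here.\<close>
    note * = integral_dither[OF E_sym[OF that] err_on_F[OF E_less(1)[OF that]] this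
        err_on_bound[OF E_less(1)[OF that] coord_less[of "Suc k"]]]
    show "integrable M (\<lambda>\<omega>. (indicator B \<omega> * err k \<omega> i ?l) * ?s \<omega> i j)" by (rule *)
    show "(\<integral>\<omega>. (indicator B \<omega> * err k \<omega> i ?l) * ?s \<omega> i j \<partial>M) = 0" by (rule *)
  qed
  have **: "integrable M (\<lambda>\<omega>. alpha (fst e) (snd e) (Suc k) * a (fst e) (snd e) *
        ((indicator B \<omega> * err k \<omega> (fst e) ?l) * ?s \<omega> (fst e) (snd e)))" if "e \<in> E" for e
    using *[of "fst e" "snd e"] that by (intro integrable_mult_right) simp
  show "integrable M (\<lambda>\<omega>. indicator B \<omega> * dither_noise k \<omega>)"
    unfolding eq by (intro Bochner_Integration.integrable_sum **)
  show "(\<integral>\<omega>. indicator B \<omega> * dither_noise k \<omega> \<partial>M) = 0"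
    unfolding eq by (subst Bochner_Integration.integral_sum[OF **]) (auto intro!: sum.neutral simp: *)
qed

lemma integral_obs_noise:
  "integrable M (\<lambda>\<omega>. indicator B \<omega> * obs_noise k \<omega>)" "(\<integral>\<omega>. indicator B \<omega> * obs_noise k \<omega> \<partial>M) = 0"
proof -
  have eq: "(\<lambda>\<omega>. indicator B \<omega> * obs_noise k \<omega>) = (\<lambda>\<omega>. \<Sum>i<N. beta i (Suc k) *
      (\<Sum>c<n. \<Sum>r<m i. H i (Suc k) r c * ((indicator B \<omega> * err k \<omega> i c) * w i (Suc k) \<omega> r)))"
    unfolding obs_noise_def sum_distrib_left by (intro ext sum.cong refl) (simp only: mult_ac)
  have *: "integrable M (\<lambda>\<omega>. (indicator B \<omega> * err k \<omega> i c) * w i (Suc k) \<omega> r)"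
    "(\<integral>\<omega>. (indicator B \<omega> * err k \<omega> i c) * w i (Suc k) \<omega> r \<partial>M) = 0" if "i < N" "c < n" "r < m i" for i c r
    using that by (intro integral_obs_noise_term[OF _ _ err_on_F err_on_bound]; simp)+
  have "has_bochner_integral M (\<lambda>\<omega>. indicator B \<omega> * obs_noise k \<omega>)
      (\<Sum>i<N. beta i (Suc k) * (\<Sum>c<n. \<Sum>r<m i. H i (Suc k) r c * 0))"
    unfolding eq by (intro has_bochner_integral_sum has_bochner_integral_mult_right) (simp add: has_bochner_integral_iff *)
  then show "integrable M (\<lambda>\<omega>. indicator B \<omega> * obs_noise k \<omega>)" "(\<integral>\<omega>. indicator B \<omega> * obs_noise k \<omega> \<partial>M) = 0"
    by (simp_all add: has_bochner_integral_iff)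
qed

text \<open>Over \<open>B\<close> both noise terms integrate to zero. What remains of the
  observation noise is its second moment on \<open>B\<close>, which the level \<open>L\<close>
  controls.\<close>

lemma integral_lyap_Suc_le:
  assumes P0: "0 \<le> P"
    and P: "\<And>\<omega>. lyap (Suc k) \<omega> \<le> (1 + 3 * P\<^sup>2 * (\<Sum>i<N. (beta i (Suc k))\<^sup>2)) * lyap k \<omega>
      + 2 * dither_noise k \<omega> + 2 * obs_noise k \<omega> + 12 * real N * (\<Sum>(i,j)\<in>E. (alpha i j (Suc k) * a i j)\<^sup>2)
      + 3 * P * (\<Sum>i<N. (beta i (Suc k))\<^sup>2 * (\<Sum>r<m i. (w i (Suc k) \<omega> r)\<^sup>2))"
    and \<rho>: "2 < \<rho>" and L: "0 \<le> L"
    and mom: "\<And>\<omega> i. \<omega> \<in> B \<Longrightarrow> i < N \<Longrightarrow> cond_mom \<rho> i (Suc k) \<omega> \<le> ennreal L"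
  shows "integrable M (\<lambda>\<omega>. indicator B \<omega> * lyap (Suc k) \<omega>)"
    and "(\<integral>\<omega>. indicator B \<omega> * lyap (Suc k) \<omega> \<partial>M)
      \<le> (1 + 3 * P\<^sup>2 * (\<Sum>i<N. (beta i (Suc k))\<^sup>2)) * (\<integral>\<omega>. indicator B \<omega> * lyap k \<omega> \<partial>M)
        + 12 * real N * (\<Sum>(i,j)\<in>E. (alpha i j (Suc k) * a i j)\<^sup>2)
        + 3 * P * (\<Sum>i<N. (beta i (Suc k))\<^sup>2 * (1 + L))"
proof -
  have B_M[measurable]: "B \<in> sets M" using B subalg_F by (auto simp: subalgebra_def)
  have lyap_M[measurable]: "lyap j \<in> borel_measurable M" for j
    by (rule measurable_from_subalg[OF subalg_F lyap_F])
  define c where "c = 3 * P\<^sup>2 * (\<Sum>i<N. (beta i (Suc k))\<^sup>2)"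
  define D where "D = 12 * real N * (\<Sum>(i,j)\<in>E. (alpha i j (Suc k) * a i j)\<^sup>2)"
  have D0: "0 \<le> D" unfolding D_def by (intro mult_nonneg_nonneg sum_nonneg) auto
  let ?W = "\<lambda>\<omega>. \<Sum>i<N. (beta i (Suc k))\<^sup>2 * (indicator B \<omega> * (\<Sum>r<m i. (w i (Suc k) \<omega> r)\<^sup>2))"
  let ?U = "\<lambda>\<omega>. (1 + c) * (indicator B \<omega> * lyap k \<omega>) + 2 * (indicator B \<omega> * dither_noise k \<omega>)
    + 2 * (indicator B \<omega> * obs_noise k \<omega>) + D * indicator B \<omega> + 3 * P * ?W \<omega>"
  have le: "indicator B \<omega> * lyap (Suc k) \<omega> \<le> ?U \<omega>" for \<omega>
    using P[of \<omega>] by (cases "\<omega> \<in> B") (simp_all add: c_def D_def)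
  note sq = integral_sq_on_le[of _ "Suc k", OF _ _ \<rho> L B_M mom]
  have intW: "integrable M ?W"
    by (intro Bochner_Integration.integrable_sum integrable_mult_right sq) auto
  have "(\<integral>\<omega>. ?W \<omega> \<partial>M) = (\<Sum>i<N. (beta i (Suc k))\<^sup>2 * (\<integral>\<omega>. indicator B \<omega> * (\<Sum>r<m i. (w i (Suc k) \<omega> r)\<^sup>2) \<partial>M))"
    by (subst Bochner_Integration.integral_sum) (auto intro!: integrable_mult_right sq)
  also have "\<dots> \<le> (\<Sum>i<N. (beta i (Suc k))\<^sup>2 * (1 + L))"
    by (intro sum_mono mult_left_mono sq) auto
  finally have W: "(\<integral>\<omega>. ?W \<omega> \<partial>M) \<le> (\<Sum>i<N. (beta i (Suc k))\<^sup>2 * (1 + L))" .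
  have intV: "integrable M (\<lambda>\<omega>. indicator B \<omega> * lyap k \<omega>)"
    by (rule integrable_const_bound[of _ "\<bar>R\<bar>"])
       (auto simp: indicator_def lyap_nonneg intro!: AE_I2 order_trans[OF bd])
  have int1: "integrable M (indicat_real B)" by (rule integrable_real_indicator) (auto simp: emeasure_eq_measure)
  have intU: "integrable M ?U"
    by (intro Bochner_Integration.integrable_add integrable_mult_right intV intW integral_dither_noise integral_obs_noise int1)
  show int: "integrable M (\<lambda>\<omega>. indicator B \<omega> * lyap (Suc k) \<omega>)"
  proof (rule Bochner_Integration.integrable_bound[OF intU])
    show "AE \<omega> in M. norm (indicator B \<omega> * lyap (Suc k) \<omega>) \<le> norm (?U \<omega>)"
    proof (rule AE_I2)
      fix \<omega>
      have "0 \<le> indicator B \<omega> * lyap (Suc k) \<omega>" using lyap_nonneg by simp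
      then show "norm (indicator B \<omega> * lyap (Suc k) \<omega>) \<le> norm (?U \<omega>)" using le[of \<omega>] unfolding real_norm_def by linarith
    qed
  qed measurable
  have "(\<integral>\<omega>. indicator B \<omega> * lyap (Suc k) \<omega> \<partial>M) \<le> (\<integral>\<omega>. ?U \<omega> \<partial>M)"
    by (rule integral_mono[OF int intU le])
  also have "\<dots> = (1 + c) * (\<integral>\<omega>. indicator B \<omega> * lyap k \<omega> \<partial>M) + D * prob B + 3 * P * (\<integral>\<omega>. ?W \<omega> \<partial>M)"
    using intV intW integral_dither_noise integral_obs_noise int1 by simp
  also have "\<dots> \<le> (1 + c) * (\<integral>\<omega>. indicator B \<omega> * lyap k \<omega> \<partial>M) + D
      + 3 * P * (\<Sum>i<N. (beta i (Suc k))\<^sup>2 * (1 + L))"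
    using W P0 D0 prob_le_1[of B] by (intro add_mono mult_left_mono order_refl mult_left_le) auto
  finally show "(\<integral>\<omega>. indicator B \<omega> * lyap (Suc k) \<omega> \<partial>M)
      \<le> (1 + 3 * P\<^sup>2 * (\<Sum>i<N. (beta i (Suc k))\<^sup>2)) * (\<integral>\<omega>. indicator B \<omega> * lyap k \<omega> \<partial>M)
        + 12 * real N * (\<Sum>(i,j)\<in>E. (alpha i j (Suc k) * a i j)\<^sup>2)
        + 3 * P * (\<Sum>i<N. (beta i (Suc k))\<^sup>2 * (1 + L))"
    by (simp only: c_def D_def)
qed

end

text \<open>Normalising by the product of the growth factors gives an almost supermartingale on
  every event where the conditional moments stay below a level. These events exhaust almost all
  paths.\<close>

lemma AE_lyap_bounded: "AE \<omega> in M. bdd_above (range (\<lambda>k. lyap k \<omega>))"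
proof -
  obtain \<rho> where \<rho>: "2 < \<rho>" and mom: "AE \<omega> in M.
      (SUP ik\<in>{(i,k). i < N \<and> 1 \<le> k}. cond_mom \<rho> (fst ik) (snd ik) \<omega>) < \<infinity>"
    using w_mom unfolding cond_mom_def by blast
  obtain P where P0: "0 \<le> P" and P: "\<And>k \<omega>. lyap (Suc k) \<omega> \<le> (1 + 3 * P\<^sup>2 * (\<Sum>i<N. (beta i (Suc k))\<^sup>2)) * lyap k \<omega>
      + 2 * dither_noise k \<omega> + 2 * obs_noise k \<omega> + 12 * real N * (\<Sum>(i,j)\<in>E. (alpha i j (Suc k) * a i j)\<^sup>2)
      + 3 * P * (\<Sum>i<N. (beta i (Suc k))\<^sup>2 * (\<Sum>r<m i. (w i (Suc k) \<omega> r)\<^sup>2))"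
    using lyap_Suc_le by blast
  define c where "c = (\<lambda>k. 3 * P\<^sup>2 * (\<Sum>i<N. (beta i (Suc k))\<^sup>2))"
  have c0: "0 \<le> c k" for k unfolding c_def by (intro mult_nonneg_nonneg sum_nonneg) auto
  have c_sum: "summable c" unfolding c_def by (intro summable_mult summable_sum beta_sq) auto
  \<comment> \<open>These products lie between 1 and \<open>exp (suminf c)\<close>, so
    \<open>lyap\<close> and its normalised form \<open>V\<close> are bounded along the same
    paths.\<close>
  define p where "p = (\<lambda>k. \<Prod>t<k. 1 + c t)"
  have p1: "1 \<le> p k" for k unfolding p_def using c0 by (intro prod_ge_1) auto
  have p_Suc: "p (Suc k) = (1 + c k) * p k" for k by (simp add: p_def)
  have p_le: "p k \<le> exp (suminf c)" for k
  proof -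
    have "p k \<le> (\<Prod>t<k. exp (c t))"
      unfolding p_def using c0 by (intro prod_mono) (auto simp: add_nonneg_nonneg)
    also have "\<dots> = exp (\<Sum>t<k. c t)" by (simp add: exp_sum)
    also have "\<dots> \<le> exp (suminf c)" using c0 c_sum by (simp add: sum_le_suminf)
    finally show ?thesis .
  qed
  define V where "V = (\<lambda>k \<omega>. lyap k \<omega> / p k)"
  have V_F: "V k \<in> borel_measurable (F k)" for k
    unfolding V_def by (intro borel_measurable_divide lyap_F borel_measurable_const)
  have bounded: "AE \<omega> in M. (\<forall>t. \<forall>i<N. cond_mom \<rho> i (Suc t) \<omega> \<le> ennreal (real L)) \<longrightarrow> bdd_above (range (\<lambda>k. V k \<omega>))"
    for L :: nat
  proof -
    \<comment> \<open>The conditional moment of the noise at time \<open>Suc t\<close> is already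
      measurable with respect to \<open>Fw t\<close>; hence \<open>A k\<close> restricts the noise
      of the coming step and still belongs to \<open>F k\<close>.\<close>
    define A where "A = (\<lambda>k. {\<omega>\<in>space M. \<forall>t\<le>k. \<forall>i<N. cond_mom \<rho> i (Suc t) \<omega> \<le> ennreal (real L)})"
    define e where "e = (\<lambda>k. 12 * real N * (\<Sum>(i,j)\<in>E. (alpha i j (Suc k) * a i j)\<^sup>2)
        + 3 * P * (\<Sum>i<N. (beta i (Suc k))\<^sup>2 * (1 + real L)))"
    have space_F: "space (F k) = space M" for k using subalg_F[of k] by (simp add: subalgebra_def)
    have A_F: "A k \<in> sets (F k)" for k
    proof -
      have "{\<omega>\<in>space (F k). cond_mom \<rho> i (Suc t) \<omega> \<le> ennreal (real L)} \<in> sets (F k)" if "t \<le> k" for i t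
      proof -
        have "cond_mom \<rho> i (Suc t) \<in> borel_measurable (Fw t)" using cond_mom_Fw[of \<rho> i "Suc t"] by simp
        from measurable_from_subalg[OF subalg_F_mono[OF that] measurable_from_subalg[OF subalg_F_Fw this]]
        have [measurable]: "cond_mom \<rho> i (Suc t) \<in> borel_measurable (F k)" .
        show ?thesis by measurable
      qed
      then have "{\<omega>\<in>space (F k). \<forall>i\<in>{..<N}. cond_mom \<rho> i (Suc t) \<omega> \<le> ennreal (real L)} \<in> sets (F k)" if "t \<in> {..k}" for t
        using that by (intro sets.sets_Collect_finite_All[OF _ finite_lessThan]) simp
      then have "{\<omega>\<in>space (F k). \<forall>t\<in>{..k}. \<forall>i\<in>{..<N}. cond_mom \<rho> i (Suc t) \<omega> \<le> ennreal (real L)} \<in> sets (F k)"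
        by (rule sets.sets_Collect_finite_All[OF _ finite_atMost])
      moreover have "A k = {\<omega>\<in>space (F k). \<forall>t\<in>{..k}. \<forall>i\<in>{..<N}. cond_mom \<rho> i (Suc t) \<omega> \<le> ennreal (real L)}"
        unfolding A_def space_F by blast
      ultimately show ?thesis by simp
    qed
    let ?B = "\<lambda>k l. {\<omega>\<in>A k. \<forall>t\<le>k. V t \<omega> < l}"
    have B_F: "?B k l \<in> sets (F k)" for k l
    proof -
      have "{\<omega>\<in>space (F k). V t \<omega> < l} \<in> sets (F k)" if "t \<le> k" for t
      proof -
        note [measurable] = measurable_from_subalg[OF subalg_F_mono[OF that] V_F]
        show ?thesis by measurable
      qed
      then have "{\<omega>\<in>space (F k). \<forall>t\<in>{..k}. V t \<omega> < l} \<in> sets (F k)"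
        by (intro sets.sets_Collect_finite_All[OF _ finite_atMost]) simp
      moreover have "?B k l = A k \<inter> {\<omega>\<in>space (F k). \<forall>t\<in>{..k}. V t \<omega> < l}"
        by (auto simp: A_def space_F)
      ultimately show ?thesis using A_F by auto
    qed
    have bd: "lyap k \<omega> \<le> l * p k" if "\<omega> \<in> ?B k l" for \<omega> k l
    proof -
      have "V k \<omega> < l" using that by auto
      then show ?thesis using p1[of k] by (simp add: V_def pos_divide_less_eq)
    qed
    have momB: "cond_mom \<rho> i (Suc k) \<omega> \<le> ennreal (real L)" if "\<omega> \<in> ?B k l" "i < N" for i \<omega> k l
      using that by (auto simp: A_def)
    have "AE \<omega> in M. (\<forall>k. \<omega> \<in> A k) \<longrightarrow> bdd_above (range (\<lambda>k. V k \<omega>))"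
    proof (rule AE_bounded_of_almost_supermartingale[where e=e])
      show "V k \<in> borel_measurable M" for k by (rule measurable_from_subalg[OF subalg_F V_F])
      show "integrable M (V 0)" by (simp add: V_def lyap_def[abs_def] err_def)
      show "0 \<le> V k \<omega>" for k \<omega> using lyap_nonneg p1[of k] by (simp add: V_def)
      show "A k \<in> sets M" for k using A_F subalg_F by (auto simp: subalgebra_def)
      show "decseq A" by (auto simp: decseq_def A_def)
      show "0 \<le> e k" for k unfolding e_def using P0
        by (intro add_nonneg_nonneg mult_nonneg_nonneg sum_nonneg) (auto split: prod.splits)
      show "summable e"
      proof -
        have "summable (\<lambda>k. (alpha (fst z) (snd z) (Suc k) * a (fst z) (snd z))\<^sup>2)" if "z \<in> E" for z
          using alpha_sq[of "fst z" "snd z"] that by (simp add: power_mult_distrib summable_mult2)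
        then show ?thesis unfolding e_def case_prod_beta
          by (intro summable_add summable_mult summable_sum summable_mult2 beta_sq) auto
      qed
    next
      fix k l
      note step = integral_lyap_Suc_le[OF B_F[of k l] bd[of _ k l] P0 P \<rho> of_nat_0_le_iff momB[of _ k l]]
      have eq: "(\<lambda>\<omega>. indicator (?B k l) \<omega> * V (Suc k) \<omega>) = (\<lambda>\<omega>. indicator (?B k l) \<omega> * lyap (Suc k) \<omega> / p (Suc k))"
        by (simp add: V_def)
      show "integrable M (\<lambda>\<omega>. indicator (?B k l) \<omega> * V (Suc k) \<omega>)"
        unfolding eq by (intro integrable_divide step(1))
      let ?I = "\<integral>\<omega>. indicator (?B k l) \<omega> * lyap k \<omega> \<partial>M"
      have e0: "0 \<le> e k" unfolding e_def using P0
        by (intro add_nonneg_nonneg mult_nonneg_nonneg sum_nonneg) (auto split: prod.splits)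
      have "(\<integral>\<omega>. indicator (?B k l) \<omega> * V (Suc k) \<omega> \<partial>M)
          = (\<integral>\<omega>. indicator (?B k l) \<omega> * lyap (Suc k) \<omega> \<partial>M) / p (Suc k)"
        unfolding eq by simp
      also have "\<dots> \<le> ((1 + c k) * ?I + e k) / p (Suc k)"
        using step(2) p1[of "Suc k"] by (intro divide_right_mono) (auto simp: c_def e_def)
      \<comment> \<open>Division by \<open>p (Suc k)\<close> cancels the growth factor
        \<open>1 + c k\<close>.\<close>
      also have "\<dots> = ?I / p k + e k / p (Suc k)"
        using c0[of k] p1[of k] by (simp add: p_Suc add_divide_distrib)
      also have "e k / p (Suc k) \<le> e k" using e0 p1[of "Suc k"] by (simp add: divide_le_eq mult_left_le_one_le mult_le_cancel_left1)
      also have "?I / p k = (\<integral>\<omega>. indicator (?B k l) \<omega> * V k \<omega> \<partial>M)" by (simp add: V_def)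
      finally show "(\<integral>\<omega>. indicator (?B k l) \<omega> * V (Suc k) \<omega> \<partial>M)
          \<le> (\<integral>\<omega>. indicator (?B k l) \<omega> * V k \<omega> \<partial>M) + e k" by simp
    qed
    then show ?thesis using AE_space by eventually_elim (auto simp: A_def)
  qed
  \<comment> \<open>Integer levels leave only countably many null sets; a path with finite supremum
    of the moments lies below one of them.\<close>
  then have "AE \<omega> in M. \<forall>L::nat. (\<forall>t. \<forall>i<N. cond_mom \<rho> i (Suc t) \<omega> \<le> ennreal (real L)) \<longrightarrow> bdd_above (range (\<lambda>k. V k \<omega>))"
    unfolding AE_all_countable by blast
  with mom show ?thesis
  proof eventually_elim
    fix \<omega>
    assume fin: "(SUP ik\<in>{(i,k). i < N \<and> 1 \<le> k}. cond_mom \<rho> (fst ik) (snd ik) \<omega>) < \<infinity>" (is "?S < \<infinity>")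
      and bdd: "\<forall>L::nat. (\<forall>t. \<forall>i<N. cond_mom \<rho> i (Suc t) \<omega> \<le> ennreal (real L)) \<longrightarrow> bdd_above (range (\<lambda>k. V k \<omega>))"
    obtain L :: nat where L: "?S \<le> ennreal (real L)"
    proof -
      have "\<exists>x. S = ennreal x \<and> 0 \<le> x" if "S < \<infinity>" for S :: ennreal using that by (cases S) auto
      from this[OF fin] obtain x where x: "?S = ennreal x" "0 \<le> x" by blast
      obtain L :: nat where "x \<le> real L" using real_arch_simple by blast
      then show thesis using x by (intro that[of L]) (simp only: ennreal_leI)
    qed
    have "cond_mom \<rho> i (Suc t) \<omega> \<le> ennreal (real L)" if "i < N" for i t
    proof -
      have "cond_mom \<rho> i (Suc t) \<omega> \<le> ?S"
        using that by (intro SUP_upper2[of "(i, Suc t)"]) auto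
      then show ?thesis using L by (rule order_trans)
    qed
    then have "bdd_above (range (\<lambda>k. V k \<omega>))" by (intro bdd[THEN spec, of L, THEN mp] allI impI)
    then obtain K where K: "\<And>k. V k \<omega> \<le> K" by (auto simp: bdd_above_def)
    have "lyap k \<omega> \<le> \<bar>K\<bar> * exp (suminf c)" for k
    proof -
      have "lyap k \<omega> = V k \<omega> * p k" using p1[of k] by (simp add: V_def)
      also have "\<dots> \<le> \<bar>K\<bar> * exp (suminf c)"
        using K[of k] p_le[of k] p1[of k] by (intro mult_mono) auto
      finally show ?thesis .
    qed
    then show "bdd_above (range (\<lambda>k. lyap k \<omega>))" by (auto intro!: bdd_aboveI)
  qed
qed

subsection \<open>The data rate\<close>

abbreviation "zeta \<equiv> zeta_SC n N a nu b alpha beta m H theta w d theta0"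
abbreviation "rate \<equiv> rate_SC n N a nu b alpha beta m H theta w d theta0"

definition tail_event :: "nat \<Rightarrow> nat \<Rightarrow> real \<Rightarrow> nat \<Rightarrow> 's set" where
  "tail_event i j R t = d i t -` {u. nu i j * ln (real t) - R / b i j < \<bar>u\<bar>} \<inter> space M"

lemma tail_event_F:
  assumes "i < N" "1 \<le> t" "t \<le> k"
  shows "tail_event i j R t \<in> sets (F k)"
proof -
  have "{u::real. nu i j * ln (real t) - R / b i j < \<bar>u\<bar>} \<in> sets borel" by measurable
  from measurable_sets[OF d_F[OF assms] this] show ?thesis
    using subalg_F[of k] unfolding tail_event_def subalgebra_def by (elim conjE) simp
qed

lemma tail_event_M: "i < N \<Longrightarrow> 1 \<le> t \<Longrightarrow> tail_event i j R t \<in> sets M"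
  using tail_event_F[of i t t j R] subalg_F[of t] unfolding subalgebra_def by (elim conjE subsetD) simp

lemma prob_tail_event_le:
  assumes "i < N" "1 \<le> t"
  shows "prob (tail_event i j R t) \<le> exp (R / b i j) * real t powr - nu i j"
proof -
  let ?c = "nu i j * ln (real t) - R / b i j"
  have "prob (tail_event i j R t) = measure (distr M borel (d i t)) {u. ?c < \<bar>u\<bar>}"
    unfolding tail_event_def by (rule measure_distr[OF d_meas[OF assms], symmetric]) measurable
  also have "\<dots> \<le> exp (- ?c)" unfolding distr_d[OF assms] by (rule measure_laplace_abs_greater_le)
  also have "\<dots> = exp (R / b i j) * real t powr - nu i j"
    using assms by (simp add: powr_def mult_exp_exp)
  finally show ?thesis .
qed

text \<open>If the later time is \<open>k + 1\<close>, the earlier event belongs to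
  \<open>F k\<close>, and independence of the past from the next dither applies.\<close>

lemma tail_event_indep:
  assumes "i < N" "1 \<le> s" "1 \<le> t" "s \<noteq> t"
  shows "prob (tail_event i j R s \<inter> tail_event i j R t) = prob (tail_event i j R s) * prob (tail_event i j R t)"
proof -
  have *: "prob (tail_event i j R s \<inter> tail_event i j R t) = prob (tail_event i j R s) * prob (tail_event i j R t)"
    if st: "1 \<le> s" "s < t" for s t
  proof -
    obtain k where k: "t = Suc k" using st by (cases t) auto
    show ?thesis unfolding k tail_event_def[of i j R "Suc k"]
      using st assms(1) by (intro indep_F_d tail_event_F) (auto simp: k)
  qed
  show ?thesis
  proof (cases "s < t")
    case False
    then show ?thesis using *[of t s] assms by (simp add: Int_commute mult.commute)
  qed (use * assms in blast)
qed

lemma zeta_le_tail_event: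
  assumes "(i, j) \<in> E" and "\<bar>est (t - 1) \<omega> i (coord n t)\<bar> \<le> R" and "\<omega> \<in> space M"
  shows "zeta i j t \<omega> \<le> indicator (tail_event i j R t) \<omega>"
proof -
  let ?x = "est (t - 1) \<omega> i (coord n t)"
  have b: "0 < b i j" by (rule b_pos[OF assms(1)])
  have "\<omega> \<in> tail_event i j R t" if "\<bar>?x + b i j * d i t \<omega>\<bar> > Cthr nu b i j t"
  proof -
    have "\<bar>?x + b i j * d i t \<omega>\<bar> \<le> R + b i j * \<bar>d i t \<omega>\<bar>"
      using abs_triangle_ineq[of ?x "b i j * d i t \<omega>"] assms(2) b by (simp add: abs_mult)
    then have "nu i j * b i j * ln (real t) - R < b i j * \<bar>d i t \<omega>\<bar>"
      using that by (simp add: Cthr_def)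
    then have "(nu i j * b i j * ln (real t) - R) / b i j < \<bar>d i t \<omega>\<bar>"
      using b by (simp add: pos_divide_less_eq mult.commute)
    then show ?thesis using b assms(3) by (simp add: tail_event_def diff_divide_distrib)
  qed
  then show ?thesis by (auto simp: zeta_SC_def Let_def)
qed

text \<open>The bound on the estimates depends on the path, so the count of tail events is
  controlled for all integers \<open>R\<close> simultaneously before \<open>R\<close> is
  chosen.\<close>

lemma AE_zeta_sum_le:
  assumes E: "(i, j) \<in> E" and nu1: "nu i j < 1"
  shows "AE \<omega> in M. \<exists>C. \<forall>k\<ge>1. (\<Sum>t=1..k. zeta i j t \<omega>) \<le> C * real k powr (1 - nu i j)"
proof -
  have i: "i < N" using E_less[OF E] by simp
  have "AE \<omega> in M. \<exists>C. \<forall>k\<ge>1. (\<Sum>t=1..k. indicator (tail_event i j (real R) t) \<omega>) \<le> C * real k powr (1 - nu i j)" for R :: nat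
    by (rule AE_count_pairwise_independent_events[OF tail_event_M[OF i] tail_event_indep[OF i] nu_nonneg[OF E] nu1
          prob_tail_event_le[OF i]])
  then have "AE \<omega> in M. \<forall>R::nat. \<exists>C. \<forall>k\<ge>1. (\<Sum>t=1..k. indicator (tail_event i j (real R) t) \<omega>) \<le> C * real k powr (1 - nu i j)"
    unfolding AE_all_countable by blast
  then show ?thesis using AE_lyap_bounded AE_space
  proof eventually_elim
    fix \<omega>
    assume cnt: "\<forall>R::nat. \<exists>C. \<forall>k\<ge>1. (\<Sum>t=1..k. indicator (tail_event i j (real R) t) \<omega>) \<le> C * real k powr (1 - nu i j)"
      and bdd: "bdd_above (range (\<lambda>k. lyap k \<omega>))" and sp: "\<omega> \<in> space M"
    from bdd obtain K where K: "\<And>k. lyap k \<omega> \<le> K" by (auto simp: bdd_above_def)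
    \<comment> \<open>\<open>1 + K\<close> bounds every error component, and the sum bounds every
      component of \<open>theta\<close>; together they bound the estimates.\<close>
    obtain R :: nat where R: "1 + K + (\<Sum>c<n. \<bar>theta c\<bar>) \<le> real R" using real_arch_simple by blast
    have est_le: "\<bar>est k \<omega> i c\<bar> \<le> real R" if "c < n" for k c
    proof -
      have "\<bar>err k \<omega> i c\<bar> \<le> 1 + (err k \<omega> i c)\<^sup>2"
        using zero_le_power2[of "\<bar>err k \<omega> i c\<bar> - 1"] by (simp add: power2_eq_square algebra_simps)
      also have "\<dots> \<le> 1 + K" using err_sq_le_lyap[OF i that, of k \<omega>] K[of k] by simp
      finally have "\<bar>err k \<omega> i c\<bar> \<le> 1 + K" .
      moreover have "\<bar>theta c\<bar> \<le> (\<Sum>c<n. \<bar>theta c\<bar>)" using that by (intro member_le_sum) auto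
      ultimately show ?thesis using R unfolding err_def by linarith
    qed
    obtain C where C: "\<forall>k\<ge>1. (\<Sum>t=1..k. indicator (tail_event i j (real R) t) \<omega>) \<le> C * real k powr (1 - nu i j)"
      using cnt by blast
    have "(\<Sum>t=1..k. zeta i j t \<omega>) \<le> C * real k powr (1 - nu i j)" if "1 \<le> k" for k
    proof -
      have "(\<Sum>t=1..k. zeta i j t \<omega>) \<le> (\<Sum>t=1..k. indicator (tail_event i j (real R) t) \<omega>)"
        by (intro sum_mono zeta_le_tail_event E est_le coord_less sp)
      then show ?thesis using C that by (meson order_trans)
    qed
    then show "\<exists>C. \<forall>k\<ge>1. (\<Sum>t=1..k. zeta i j t \<omega>) \<le> C * real k powr (1 - nu i j)" by blast
  qed
qed

text \<open>Each edge contributes at the rate of its own exponent, and for \<open>k \<ge> 1\<close>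
  the smallest exponent dominates.\<close>

lemma AE_rate_bounded:
  assumes nu1: "\<And>i j. (i, j) \<in> E \<Longrightarrow> nu i j < 1"
  shows "AE \<omega> in M. bdd_above ((\<lambda>k. \<bar>rate k \<omega>\<bar> / real k powr (- Min {nu i j | i j. (i, j) \<in> E})) ` {1..})"
proof (cases "E = {}")
  case True
  then show ?thesis by (auto simp: rate_SC_def intro!: bdd_aboveI[of _ 0])
next
  case False
  define \<mu> where "\<mu> = Min {nu i j | i j. (i, j) \<in> E}"
  have img: "{nu i j | i j. (i, j) \<in> E} = (\<lambda>(i,j). nu i j) ` E" by auto
  have \<mu>: "\<mu> \<le> nu (fst z) (snd z)" if "z \<in> E" for z
    unfolding \<mu>_def img using that finite_edges by (intro Min_le) (auto simp: image_iff case_prod_beta)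
  have "AE \<omega> in M. \<exists>C. \<forall>k\<ge>1. (\<Sum>t=1..k. zeta (fst z) (snd z) t \<omega>) \<le> C * real k powr (1 - nu (fst z) (snd z))"
    if "z \<in> E" for z
    using that by (intro AE_zeta_sum_le nu1) auto
  then have "AE \<omega> in M. \<forall>z\<in>E. \<exists>C. \<forall>k\<ge>1. (\<Sum>t=1..k. zeta (fst z) (snd z) t \<omega>) \<le> C * real k powr (1 - nu (fst z) (snd z))"
    by (intro AE_finite_allI finite_edges)
  then show ?thesis
  proof eventually_elim
    fix \<omega> assume "\<forall>z\<in>E. \<exists>C. \<forall>k\<ge>1. (\<Sum>t=1..k. zeta (fst z) (snd z) t \<omega>) \<le> C * real k powr (1 - nu (fst z) (snd z))"
    then obtain C where C: "\<And>z k. z \<in> E \<Longrightarrow> 1 \<le> k \<Longrightarrow>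
        (\<Sum>t=1..k. zeta (fst z) (snd z) t \<omega>) \<le> C z * real k powr (1 - nu (fst z) (snd z))" by metis
    \<comment> \<open>The normalisation \<open>2 * k * (card E / 2)\<close> is
      \<open>k * card E\<close>, so the edge constants are averaged over ordered edges.\<close>
    define K where "K = (\<Sum>z\<in>E. \<bar>C z\<bar>) / real (card E)"
    have "\<bar>rate k \<omega>\<bar> / real k powr - \<mu> \<le> K" if k: "1 \<le> k" for k
    proof -
      let ?S = "\<Sum>(i,j)\<in>E. \<Sum>t=1..k. zeta i j t \<omega>"
      have S0: "0 \<le> ?S" by (intro sum_nonneg) (auto intro!: sum_nonneg simp: zeta_SC_def Let_def)
      have S_le: "?S \<le> (\<Sum>z\<in>E. \<bar>C z\<bar>) * real k powr (1 - \<mu>)"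
        unfolding sum_distrib_right case_prod_beta
      proof (rule sum_mono)
        fix z assume z: "z \<in> E"
        have "(\<Sum>t=1..k. zeta (fst z) (snd z) t \<omega>) \<le> C z * real k powr (1 - nu (fst z) (snd z))" by (rule C[OF z k])
        also have "\<dots> \<le> \<bar>C z\<bar> * real k powr (1 - \<mu>)"
          using \<mu>[OF z] k by (intro mult_mono powr_mono) auto
        finally show "(\<Sum>t=1..k. zeta (fst z) (snd z) t \<omega>) \<le> \<bar>C z\<bar> * real k powr (1 - \<mu>)" .
      qed
      have cE: "0 < real (card E)" using False finite_edges by (simp add: card_gt_0_iff)
      have rate: "rate k \<omega> = ?S / (real k * real (card E))" by (simp add: rate_SC_def)
      have kp: "real k powr (1 - \<mu>) = real k * real k powr - \<mu>" using k by (simp add: powr_diff powr_minus divide_inverse)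
      have "\<bar>rate k \<omega>\<bar> = ?S / (real k * real (card E))" unfolding rate using S0 by (simp add: abs_mult)
      also have "\<dots> \<le> ((\<Sum>z\<in>E. \<bar>C z\<bar>) * real k powr (1 - \<mu>)) / (real k * real (card E))"
        by (intro divide_right_mono S_le) auto
      also have "\<dots> = K * real k powr - \<mu>" using k by (simp add: kp K_def)
      finally show ?thesis using k by (simp add: pos_divide_le_eq)
    qed
    then show "bdd_above ((\<lambda>k. \<bar>rate k \<omega>\<bar> / real k powr (- Min {nu i j | i j. (i, j) \<in> E})) ` {1..})"
      unfolding \<mu>_def by (auto intro!: bdd_aboveI[of _ K])
  qed
qed

text \<open>If \<open>\<nu> > 1/2\<close>, the bound \<open>x y \<le> x\<^sup>2 + y\<^sup>2\<close> with \<open>x = \<alpha>\<^sub>k\<close> and \<open>y = 1 / k powr \<nu>\<close> makes the step sizes summable.\<close>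

lemma nu_le_half:
  assumes z_div: "\<not> summable (\<lambda>k. Min ({alpha i j (Suc k) / real (Suc k) powr nu i j | i j. (i, j) \<in> E}
                                       \<union> {beta i (Suc k) | i. i < N}))"
    and E: "(i, j) \<in> E"
  shows "nu i j \<le> 1 / 2"
proof (rule ccontr)
  assume "\<not> nu i j \<le> 1 / 2"
  then have nu: "1 / 2 < nu i j" by simp
  let ?Z = "\<lambda>k. {alpha i j (Suc k) / real (Suc k) powr nu i j | i j. (i, j) \<in> E} \<union> {beta i (Suc k) | i. i < N}"
  have fin: "finite (?Z k)" for k
  proof -
    have "{alpha i j (Suc k) / real (Suc k) powr nu i j | i j. (i, j) \<in> E}
        = (\<lambda>(i,j). alpha i j (Suc k) / real (Suc k) powr nu i j) ` E" by auto
    then show ?thesis using finite_edges by simp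
  qed
  have mem: "alpha i j (Suc k) / real (Suc k) powr nu i j \<in> ?Z k" for k using E by blast
  \<comment> \<open>Nonnegativity turns the upper bound on the minimum into a bound on its norm, as
    the comparison test requires.\<close>
  have Z0: "0 \<le> Min (?Z k)" for k
  proof -
    have "Min (?Z k) \<in> ?Z k" using fin mem[of k] by (intro Min_in) auto
    then show ?thesis using alpha_pos[of _ _ "Suc k"] beta_pos[of _ "Suc k"] by (force intro: less_imp_le)
  qed
  have "summable (\<lambda>k. Min (?Z k))"
  proof (rule summable_comparison_test')
    show "summable (\<lambda>k. (alpha i j (Suc k))\<^sup>2 + real (Suc k) powr - (2 * nu i j))"
    proof (intro summable_add alpha_sq[OF E])
      have "summable (\<lambda>k. real k powr - (2 * nu i j))" using nu by (subst summable_real_powr_iff) simp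
      then show "summable (\<lambda>k. real (Suc k) powr - (2 * nu i j))" by (subst summable_Suc_iff)
    qed
    fix k :: nat
    let ?q = "real (Suc k) powr - nu i j"
    have "Min (?Z k) \<le> alpha i j (Suc k) / real (Suc k) powr nu i j" by (intro Min_le fin mem)
    also have "\<dots> = alpha i j (Suc k) * ?q" by (simp add: powr_minus divide_inverse)
    also have "\<dots> \<le> (alpha i j (Suc k))\<^sup>2 + ?q\<^sup>2"
    proof -
      have "0 \<le> alpha i j (Suc k) * ?q" using alpha_pos[OF E, of "Suc k"] by (intro mult_nonneg_nonneg) auto
      then show ?thesis using sum_squares_bound[of "alpha i j (Suc k)" ?q] by linarith
    qed
    also have "?q\<^sup>2 = real (Suc k) powr - (2 * nu i j)"
      by (simp add: power2_eq_square powr_add[symmetric])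
    finally show "norm (Min (?Z k)) \<le> (alpha i j (Suc k))\<^sup>2 + real (Suc k) powr - (2 * nu i j)"
      using Z0[of k] by simp
  qed
  then show False using z_div by simp
qed

end

theorem theorem5p2:
  fixes M :: "'s measure"
    and n N :: nat
    and a nu b :: "nat \<Rightarrow> nat \<Rightarrow> real"
    and alpha :: "nat \<Rightarrow> nat \<Rightarrow> nat \<Rightarrow> real"
    and beta :: "nat \<Rightarrow> nat \<Rightarrow> real"
    and m :: "nat \<Rightarrow> nat"
    and H :: "nat \<Rightarrow> nat \<Rightarrow> nat \<Rightarrow> nat \<Rightarrow> real"
    and theta :: "nat \<Rightarrow> real"
    and w :: "nat \<Rightarrow> nat \<Rightarrow> 's \<Rightarrow> nat \<Rightarrow> real"
    and d :: "nat \<Rightarrow> nat \<Rightarrow> 's \<Rightarrow> real"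
    and theta0 :: "nat \<Rightarrow> nat \<Rightarrow> real"
  defines "E \<equiv> edges N a"
  assumes prob: "prob_space M"
    and dim: "0 < n"
    \<comment> \<open>graph: symmetric nonnegative weights\<close>
    and a_sym: "\<And>i j. a i j = a j i"
    and a_nonneg: "\<And>i j. 0 \<le> a i j"
    \<comment> \<open>(A1)\<close>
    and A1_bound: "\<exists>Hb>0. \<forall>i<N. \<forall>k\<ge>1. \<forall>x.
                     vnorm (m i) (matvec (m i) n (H i k) x) \<le> Hb * vnorm n x"
    and A1_pe: "\<exists>p::nat. p > 0 \<and> (\<exists>\<delta>>0. \<forall>k\<ge>1. \<forall>x.
                  (1 / real p) * (\<Sum>t=k..k+p-1. \<Sum>i<N. (vnorm (m i) (matvec (m i) n (H i t) x))\<^sup>2)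
                    \<ge> \<delta> * (vnorm n x)\<^sup>2)"
    \<comment> \<open>(A2)\<close>
    and w_meas: "\<And>i k r. i < N \<Longrightarrow> 1 \<le> k \<Longrightarrow> r < m i \<Longrightarrow> (\<lambda>\<omega>. w i k \<omega> r) \<in> borel_measurable M"
    and w_int: "\<And>i k r. i < N \<Longrightarrow> 1 \<le> k \<Longrightarrow> r < m i \<Longrightarrow> integrable M (\<lambda>\<omega>. w i k \<omega> r)"
    and w_mds: "\<And>i k r. i < N \<Longrightarrow> 1 \<le> k \<Longrightarrow> r < m i \<Longrightarrow>
                  AE \<omega> in M. real_cond_exp M (filtF M N m w d (k - 1)) (\<lambda>\<omega>. w i k \<omega> r) \<omega> = 0"
    and w_mom: "\<exists>\<rho>>2. AE \<omega> in M.
                  (SUP ik\<in>{(i,k). i < N \<and> 1 \<le> k}.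
                     nn_cond_exp M (filtFw M N m w (snd ik - 1))
                       (\<lambda>\<omega>'. ennreal (vnorm (m (fst ik)) (w (fst ik) (snd ik) \<omega>') powr \<rho>)) \<omega>) < \<infinity>"
    \<comment> \<open>(A3)\<close>
    and A3: "\<forall>i<N. \<forall>j<N. (i, j) \<in> E\<^sup>*"
    \<comment> \<open>(A4)\<close>
    and d_lap: "\<And>i k. i < N \<Longrightarrow> 1 \<le> k \<Longrightarrow>
                  distributed M lborel (d i k) (\<lambda>x. ennreal (exp (- \<bar>x\<bar>) / 2))"
    and d_indep: "prob_space.indep_sets M
                    (\<lambda>z. case z of
                        None \<Rightarrow> gen_sets M {(\<lambda>\<omega>. w i t \<omega> r) | i t r. i < N \<and> 1 \<le> t \<and> r < m i}
                      | Some (i, k) \<Rightarrow> gen_sets M {d i k})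
                    ({None} \<union> {Some (i, k) | i k. i < N \<and> 1 \<le> k})"
    \<comment> \<open>algorithm parameters\<close>
    and nu_sym: "\<And>i j. (i, j) \<in> E \<Longrightarrow> nu i j = nu j i"
    and nu_nonneg: "\<And>i j. (i, j) \<in> E \<Longrightarrow> 0 \<le> nu i j"
    and b_sym: "\<And>i j. (i, j) \<in> E \<Longrightarrow> b i j = b j i"
    and b_pos: "\<And>i j. (i, j) \<in> E \<Longrightarrow> 0 < b i j"
    and alpha_sym: "\<And>i j k. (i, j) \<in> E \<Longrightarrow> 1 \<le> k \<Longrightarrow> alpha i j k = alpha j i k"
    and alpha_pos: "\<And>i j k. (i, j) \<in> E \<Longrightarrow> 1 \<le> k \<Longrightarrow> 0 < alpha i j k"
    and beta_pos: "\<And>i k. i < N \<Longrightarrow> 1 \<le> k \<Longrightarrow> 0 < beta i k"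
    \<comment> \<open>step size conditions (i)-(iii)\<close>
    and alpha_sq: "\<And>i j. (i, j) \<in> E \<Longrightarrow> summable (\<lambda>k. (alpha i j (Suc k))\<^sup>2)"
    and alpha_ratio: "\<And>i j. (i, j) \<in> E \<Longrightarrow>
                        bdd_above ((\<lambda>k. alpha i j (k + 1) / alpha i j k) ` {1..})"
    and beta_sq: "\<And>i. i < N \<Longrightarrow> summable (\<lambda>k. (beta i (Suc k))\<^sup>2)"
    and beta_ratio: "\<And>i. i < N \<Longrightarrow> bdd_above ((\<lambda>k. beta i (k + 1) / beta i k) ` {1..})"
    and z_div: "\<not> summable (\<lambda>k. Min ({alpha i j (Suc k) / real (Suc k) powr nu i j | i j. (i, j) \<in> E}
                                       \<union> {beta i (Suc k) | i. i < N}))"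
  shows "AE \<omega> in M. bdd_above
           ((\<lambda>k. \<bar>rate_SC n N a nu b alpha beta m H theta w d theta0 k \<omega>\<bar>
                   / real k powr (- Min {nu i j | i j. (i, j) \<in> E})) ` {1..})"
proof -
  interpret SC_algorithm M n N a nu b alpha beta m H theta w d theta0
    by (rule SC_algorithm.intro[OF prob SC_algorithm_axioms.intro[OF dim a_sym A1_bound w_meas w_int w_mds w_mom
          d_lap d_indep nu_sym[unfolded E_def] nu_nonneg[unfolded E_def] b_sym[unfolded E_def] b_pos[unfolded E_def]
          alpha_sym[unfolded E_def] alpha_pos[unfolded E_def] beta_pos alpha_sq[unfolded E_def] beta_sq]])
  \<comment> \<open>An exponent below 1 is what the counting of tail events requires.\<close>
  have "nu i j < 1" if "(i, j) \<in> edges N a" for i j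
    using nu_le_half[OF z_div[unfolded E_def] that] by simp
  then show ?thesis unfolding E_def by (rule AE_rate_bounded)
qed

end
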